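(* Under the noiseless model, there is a constant $C>0$, not depending on $n$, such that for all $n\ge 2$, $$\inf_{\hat M}\ \sup_{Q\in\mathcal{Q}}\ \mathbb{E}_{Q^n}\big[H(\hat M,M)\big]\ \le\ C\left(\frac{\log n}{n}\right)^{2/d},$$ where the infimum is over all estimators $\hat M=\hat M(Y_1,\dots,Y_n)$ based on an i.i.d. sample $Y_1,\dots,Y_n\sim Q$.
   Context: Fix integers $1\le d<D$, a constant $\kappa>0$ and a compact set $\mathcal{K}\subset\mathbb{R}^D$. For sets $A,B\subset\mathbb{R}^D$ the Hausdorff distance is $H(A,B)=\inf\{\varepsilon: A\subset B\oplus\varepsilon \text{ and } B\subset A\oplus\varepsilon\}$, where $A\oplus\varepsilon=\bigcup_{x\in A}B_D(x,\varepsilon)$ and $B_D(x,\varepsilon)$ is the open Euclidean ball of radius $\varepsilon$ centered at $x$. For a manifold $M\subset\mathbb{R}^D$, $\Delta(M)$ (the reach, or condition number) is the largest $r$ such that each point of $M\oplus r$ has a unique projection onto $M$. $\mathcal{M}(\kappa)$ is the set of all $d$-dimensional smooth Riemannian submanifolds (without boundary) embedded in $\mathbb{R}^D$ with $\Delta(M)\ge\kappa$. Noiseless model: $\mathcal{M}=\{M\in\mathcal{M}(\kappa): M\subset\mathcal{K}\}$. Fix constants $0<b(\mathcal{M})\le B(\mathcal{M})<\infty$ that may depend on the class $\mathcal{M}$ but not on the particular $M$. For $M\in\mathcal{M}$, $\mathcal{G}(M)$ is the set of probability distributions $G$ supported on $M$ having a density $g$ with respect to the uniform distribution on $M$ with $b(\mathcal{M})\le\inf_{y\in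 M}g(y)\le\sup_{y\in M}g(y)\le B(\mathcal{M})$. The observations are i.i.d. $Y_1,\dots,Y_n\sim Q=G$, and $\mathcal{Q}=\bigcup_{M\in\mathcal{M}}\mathcal{G}(M)$. In the risk, $M$ denotes the manifold supporting the distribution $G=Q$, and $Q^n$ is the $n$-fold product measure. *)

theory Defs
  imports "HOL-Probability.Probability"
begin

definition enlargement :: "'a::metric_space set \<Rightarrow> real \<Rightarrow> 'a set" where
  "enlargement A \<epsilon> = (\<Union>x\<in>A. ball x \<epsilon>)"

text \<open>
  The value is infinite if no admissible \<open>\<epsilon>\<close> exists, for example if one set is bounded and
  the other is not, or if exactly one of them is empty.
\<close>
definition hausdorff_dist :: "'a::metric_space set \<Rightarrow> 'a set \<Rightarrow> ennreal" where
  "hausdorff_dist A B =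
     Inf {ennreal \<epsilon> | \<epsilon>. 0 < \<epsilon> \<and> A \<subseteq> enlargement B \<epsilon> \<and> B \<subseteq> enlargement A \<epsilon>}"

definition reach :: "'a::metric_space set \<Rightarrow> ennreal" where
  "reach M = Sup {ennreal r | r. 0 \<le> r \<and>
     (\<forall>x\<in>enlargement M r. \<exists>!p. p \<in> M \<and> dist x p = infdist x M)}"

text \<open>
  \<open>k\<close>-fold continuous differentiability; intended for open \<open>S\<close> in a Euclidean space. All iterated
  directional derivatives up to order \<open>k\<close> exist (as values of Frechet derivatives) and are
  continuous.
\<close>
primrec Ck_on :: "nat \<Rightarrow> 'a::real_normed_vector set \<Rightarrow> ('a \<Rightarrow> 'b::real_normed_vector) \<Rightarrow> bool" where
  "Ck_on 0 S = (\<lambda>f. continuous_on S f)"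
| "Ck_on (Suc k) S = (\<lambda>f. (\<forall>x\<in>S. f differentiable (at x)) \<and>
     (\<forall>v. Ck_on k S (\<lambda>x. frechet_derivative f (at x) v)))"

definition smooth_on :: "'a::real_normed_vector set \<Rightarrow> ('a \<Rightarrow> 'b::real_normed_vector) \<Rightarrow> bool" where
  "smooth_on S f \<longleftrightarrow> (\<forall>k. Ck_on k S f)"

text \<open>
  Embedded smooth submanifolds without boundary, by slice charts: around each of its points, \<open>M\<close> is
  straightened to a piece of a \<open>d\<close>-dimensional linear subspace by a diffeomorphism between open
  subsets of the ambient space. The Riemannian metric is the one induced by the ambient inner
  product.
\<close>
definition smooth_submanifold :: "nat \<Rightarrow> 'a::euclidean_space set \<Rightarrow> bool" where
  "smooth_submanifold d M \<longleftrightarrow> M \<noteq> {} \<and>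
     (\<forall>p\<in>M. \<exists>U V S :: 'a set. \<exists>\<phi> \<psi>. open U \<and> p \<in> U \<and> open V \<and>
        homeomorphism U V \<phi> \<psi> \<and> smooth_on U \<phi> \<and> smooth_on V \<psi> \<and>
        subspace S \<and> dim S = d \<and> \<phi> ` (M \<inter> U) = S \<inter> V)"

definition manifolds :: "nat \<Rightarrow> real \<Rightarrow> 'a::euclidean_space set set" where
  "manifolds d \<kappa> = {M. smooth_submanifold d M \<and> ennreal \<kappa> \<le> reach M}"

definition noiseless_manifolds :: "nat \<Rightarrow> real \<Rightarrow> 'a::euclidean_space set \<Rightarrow> 'a set set" where
  "noiseless_manifolds d \<kappa> K = {M \<in> manifolds d \<kappa>. M \<subseteq> K}"

text \<open>
  The \<open>d\<close>-dimensional Hausdorff measure, for \<open>d \<ge> 1\<close> and without the usual normalising constant.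
  On a \<open>d\<close>-dimensional submanifold it is a constant multiple of the Riemannian volume, and the
  constant cancels in the uniform distribution below. Covering sets are required to be bounded
  because \<open>diameter\<close> is meaningless on unbounded sets.
\<close>
definition hausdorff_outer :: "nat \<Rightarrow> 'a::metric_space set \<Rightarrow> ennreal" where
  "hausdorff_outer d A =
     (SUP \<delta>\<in>{0<..}. INF C\<in>{C :: nat \<Rightarrow> 'a set. A \<subseteq> (\<Union>i. C i) \<and>
                               (\<forall>i. bounded (C i) \<and> diameter (C i) \<le> \<delta>)}.
        \<Sum>i. ennreal (diameter (C i) ^ d))"

definition hausdorff_measure :: "nat \<Rightarrow> 'a::metric_space measure" where
  "hausdorff_measure d = measure_of UNIV (sets borel) (hausdorff_outer d)"

definition uniform_on :: "nat \<Rightarrow> 'a::euclidean_space set \<Rightarrow> 'a measure" where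
  "uniform_on d M = uniform_measure (hausdorff_measure d) M"

definition dists_on :: "nat \<Rightarrow> real \<Rightarrow> real \<Rightarrow> 'a::euclidean_space set \<Rightarrow> 'a measure set" where
  "dists_on d b B M = {G. prob_space G \<and>
     (\<exists>g :: 'a \<Rightarrow> real. g \<in> borel_measurable borel \<and> (\<forall>y\<in>M. b \<le> g y \<and> g y \<le> B) \<and>
        G = density (uniform_on d M) (\<lambda>y. ennreal (g y)))}"

definition noiseless_model ::
    "nat \<Rightarrow> real \<Rightarrow> 'a::euclidean_space set \<Rightarrow> real \<Rightarrow> real \<Rightarrow> 'a measure set" where
  "noiseless_model d \<kappa> K b B = (\<Union>M\<in>noiseless_manifolds d \<kappa> K. dists_on d b B M)"

text \<open>
  Set-valued estimators based on \<open>n\<close> observations \<open>y 0, \<dots>, y (n - 1)\<close>. The measurability condition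
  makes the expected loss well defined; for estimators with nonempty compact values it is Borel
  measurability with respect to the Hausdorff metric.
\<close>
definition estimators :: "nat \<Rightarrow> ((nat \<Rightarrow> 'a::euclidean_space) \<Rightarrow> 'a set) set" where
  "estimators n = {Mhat. \<forall>A. compact A \<and> A \<noteq> {} \<longrightarrow>
     (\<lambda>y. hausdorff_dist (Mhat y) A) \<in> borel_measurable (Pi\<^sub>M {..<n} (\<lambda>_. borel))}"

text \<open>
  The inner supremum only names the manifold that supports \<open>Q\<close>: as the densities are bounded away
  from zero, it is the unique \<open>M\<close> in the class with \<open>Q \<in> dists_on d b B M\<close>.
\<close>
definition minimax_risk ::
    "nat \<Rightarrow> real \<Rightarrow> 'a::euclidean_space set \<Rightarrow> real \<Rightarrow> real \<Rightarrow> nat \<Rightarrow> ennreal" where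
  "minimax_risk d \<kappa> K b B n =
     (INF Mhat\<in>estimators n.
        SUP Q\<in>noiseless_model d \<kappa> K b B.
          SUP M\<in>{M \<in> noiseless_manifolds d \<kappa> K. Q \<in> dists_on d b B M}.
            \<integral>\<^sup>+ y. hausdorff_dist (Mhat y) M \<partial>(Pi\<^sub>M {..<n} (\<lambda>_. Q)))"

end

theory Submission
  imports Defs
begin

text \<open>
  Every manifold \<open>M\<close> of the class is compact, lies in a fixed ball, and every point at distance less
  than \<open>\<kappa>\<close> from \<open>M\<close> has a unique nearest point on \<open>M\<close>. The geometry is governed by the
  \<^emph>\<open>proximal normals\<close> at \<open>x \<in> M\<close>: the vectors \<open>v\<close> with \<open>(y - x) \<bullet> v \<le> c |y - x|\<^sup>2\<close> for all
  \<open>y \<in> M\<close> and some constant \<open>c\<close>, that is, the directions in which a small ball touches \<open>M\<close> at \<open>x\<close>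
  from outside. Two facts about them are used throughout.

  First, uniqueness of nearest points makes \<open>c\<close> universal: a Brouwer fixed-point argument extends a
  small touching ball to radius \<open>\<kappa>\<close>, so \<open>c = |v| / (2 \<kappa>)\<close> works (\<open>proximal_normal_reach\<close>).
  Second, in a smooth chart the proximal normals at \<open>x\<close> are exactly the orthogonal complement of
  the \<open>d\<close>-dimensional tangent space (\<open>proximal_normals_smooth_submanifold\<close>). In particular they
  form a linear space, so whenever \<open>v\<close> is a proximal normal, so is \<open>-v\<close>, and
  \<open>|(y - x) \<bullet> v| \<le> |v| |y - x|\<^sup>2 / (2 \<kappa>)\<close>. The second fact is where smoothness
  and the dimension enter.

  These facts give the square in the rate. Let \<open>M\<close> and \<open>M'\<close> be in the class and suppose that the
  points of \<open>M\<close> within \<open>\<eta>\<close> of \<open>M'\<close> are \<open>\<rho>\<close>-dense in \<open>M\<close>. At a point \<open>p \<in> M\<close> where the distance to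
  \<open>M'\<close> is largest, the direction \<open>u\<close> from \<open>M'\<close> to \<open>p\<close> is a proximal normal of \<open>M\<close>, by maximality.
  Hence near \<open>p\<close> the distance to \<open>M'\<close> can drop only quadratically, and comparison with a point of
  the dense set at distance at most \<open>\<rho>\<close> from \<open>p\<close> bounds the maximum by \<open>\<eta> + O(\<rho>\<^sup>2)\<close>
  (\<open>infdist_le_of_near_net\<close>).

  The estimator picks, from a finite \<open>\<eta>\<close>-net of the class in the Hausdorff metric, the first
  manifold that is within \<open>\<eta>\<close> of all observations and is covered by balls of radius \<open>\<epsilon> + \<eta>\<close> around
  them. Its selection criterion is
  measurable and its values form a finite family, so it is admissible. If the sample is \<open>\<epsilon>\<close>-dense in the
  true manifold, such a member exists and, by the preceding paragraph applied in both directions,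
  its error is \<open>O(\<eta> + \<epsilon>\<^sup>2)\<close> (\<open>first_fit_error_le\<close>).

  It remains to choose \<open>\<epsilon>\<close> so that the sample is \<open>\<epsilon>\<close>-dense with high probability. This needs
  \<open>Q (ball x r) \<ge> q r\<^sup>d\<close> uniformly over the class (\<open>emeasure_ball_ge\<close>), hence a lower bound for the
  Hausdorff measure of \<open>M \<inter> ball x r\<close> and an upper bound for that of \<open>M\<close>. The lower bound holds
  because the orthogonal projection of \<open>M \<inter> ball x r\<close> to the tangent space at \<open>x\<close> covers a disc of
  radius proportional to \<open>r\<close> (\<open>tangent_projection_covers_disc\<close>). The upper bound follows from a
  packing estimate: the normal fibres over \<open>\<delta>\<close>-separated points of \<open>M\<close> stay disjoint after
  thickening by \<open>\<delta> / 4\<close>, each contains of order \<open>\<delta>\<close> to the power \<open>d - D\<close> disjoint balls of radius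
  \<open>\<delta> / 4\<close>, where \<open>D\<close> is the dimension of the ambient space, and all of them lie in a fixed ball
  (\<open>card_separated_le\<close>). With \<open>\<epsilon>\<^sup>d = A ln n / n\<close> for a large constant \<open>A\<close> and \<open>\<eta> = \<epsilon>\<^sup>2\<close>, a
  union bound over an \<open>\<epsilon> / 2\<close>-net makes the probability of failure negligible against
  \<open>\<epsilon>\<^sup>2\<close>, which is of order \<open>(ln n / n) powr (2 / d)\<close>.
\<close>

section \<open>Proximal normals and sets of positive reach\<close>

text \<open>
  The constant \<open>c\<close> may depend on \<open>v\<close> and \<open>x\<close>. That a single constant serves all \<open>x\<close> is a theorem
  about sets of positive reach.
\<close>
definition proximal_normals :: "'a::real_inner set \<Rightarrow> 'a \<Rightarrow> 'a set" where
  "proximal_normals M x = {v. \<exists>c. \<forall>y\<in>M. (y - x) \<bullet> v \<le> c * (norm (y - x))\<^sup>2}"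

lemma nearest_iff_inner_le:
  fixes a v y :: "'a::real_inner"
  shows "norm v \<le> dist (a + v) y \<longleftrightarrow> 2 * ((y - a) \<bullet> v) \<le> (norm (y - a))\<^sup>2"
proof -
  have "norm v \<le> dist (a + v) y \<longleftrightarrow> (norm v)\<^sup>2 \<le> (dist (a + v) y)\<^sup>2"
    by (metis norm_ge_zero power2_le_imp_le power_mono zero_le_dist)
  also have "(dist (a + v) y)\<^sup>2 = (norm v)\<^sup>2 - 2 * ((y - a) \<bullet> v) + (norm (y - a))\<^sup>2"
    by (simp add: dist_norm power2_norm_eq_inner inner_diff_left inner_diff_right inner_add_left
        inner_add_right inner_commute algebra_simps)
  finally show ?thesis by auto
qed

text \<open>
  The condition \<open>reach M \<ge> \<kappa>\<close> for compact \<open>M\<close>. Existence of nearest points is automatic by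
  compactness, so only uniqueness is assumed.
\<close>
locale positive_reach =
  fixes M :: "'a::euclidean_space set" and \<kappa> :: real
  assumes compact_M: "compact M" and M_nonempty: "M \<noteq> {}" and \<kappa>_pos: "0 < \<kappa>"
    and unique_nearest:
      "\<And>x p q. \<lbrakk>infdist x M < \<kappa>; p \<in> M; q \<in> M; dist x p = infdist x M; dist x q = infdist x M\<rbrakk>
        \<Longrightarrow> p = q"
begin

abbreviation proj :: "'a \<Rightarrow> 'a" where "proj \<equiv> closest_point M"

lemma closed_M: "closed M"
  using compact_M by (rule compact_imp_closed)

lemma proj_in: "proj x \<in> M"
  using closed_M M_nonempty by (rule closest_point_in_set)

lemma dist_proj: "dist x (proj x) = infdist x M"
proof -
  obtain p where "p \<in> M" "infdist x M = dist x p"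
    using infdist_attains_inf[OF closed_M M_nonempty] by blast
  moreover have "dist x (proj x) \<le> dist x p"
    using closest_point_le[OF closed_M \<open>p \<in> M\<close>] .
  ultimately show ?thesis
    using infdist_le[OF proj_in, of x x] by simp
qed

lemma proj_eqI:
  assumes "infdist x M < \<kappa>" "p \<in> M" "\<And>y. y \<in> M \<Longrightarrow> dist x p \<le> dist x y"
  shows "proj x = p"
proof (rule unique_nearest[OF assms(1) proj_in assms(2) dist_proj])
  have "dist x p \<le> infdist x M"
    using assms(3)[OF proj_in, of x] dist_proj by simp
  then show "dist x p = infdist x M"
    using infdist_le[OF assms(2), of x] by simp
qed

text \<open>
  Away from \<open>proj x\<close> the distance from \<open>x\<close> to \<open>M\<close> is bounded below by a number exceeding
  \<open>infdist x M\<close>, by compactness and uniqueness. Moving \<open>x\<close> by less than half of this gap cannot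
  push the nearest point out of a neighbourhood of \<open>proj x\<close>.
\<close>
lemma continuous_on_proj: "continuous_on {x. infdist x M < \<kappa>} proj"
  unfolding continuous_on_iff
proof (intro ballI allI impI)
  fix x :: 'a and e :: real
  assume x: "x \<in> {x. infdist x M < \<kappa>}" and e: "0 < e"
  let ?F = "M - ball (proj x) e"
  show "\<exists>\<delta>>0. \<forall>x'\<in>{x. infdist x M < \<kappa>}. dist x' x < \<delta> \<longrightarrow> dist (proj x') (proj x) < e"
  proof (cases "?F = {}")
    case True
    then have "dist (proj x') (proj x) < e" for x'
      using proj_in[of x'] by (auto simp: dist_commute)
    then show ?thesis by (intro exI[of _ 1]) auto
  next
    case False
    have cl: "closed ?F" using closed_M by (simp add: closed_Diff)
    obtain q where q: "q \<in> ?F" "infdist x ?F = dist x q"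
      using infdist_attains_inf[OF cl False] by blast
    have "infdist x M \<noteq> dist x q"
    proof
      assume "infdist x M = dist x q"
      then have "q = proj x"
        using x q(1) by (intro unique_nearest[of x q "proj x"] proj_in dist_proj) auto
      then show False using q(1) e by auto
    qed
    then have gap: "infdist x M < dist x q"
      using infdist_le[of q M x] q by auto
    show ?thesis
    proof (intro exI[of _ "(dist x q - infdist x M) / 2"] conjI ballI impI)
      fix x' assume "dist x' x < (dist x q - infdist x M) / 2"
      moreover have "infdist x' M \<le> infdist x M + dist x' x"
        by (rule infdist_triangle)
      moreover have "dist x (proj x') \<le> dist x' x + infdist x' M"
        using dist_triangle[of x "proj x'" x'] dist_proj[of x'] by (simp add: dist_commute)
      ultimately have "dist x (proj x') < dist x q" by simp
      then have "proj x' \<notin> ?F" using q(2) infdist_le[of "proj x'" ?F x] by auto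
      then show "dist (proj x') (proj x) < e" using proj_in by (auto simp: dist_commute)
    qed (use gap in auto)
  qed
qed

text \<open>
  If a ball of some radius \<open>t0 > 0\<close> touches \<open>M\<close> only from outside at \<open>a\<close> in direction \<open>v\<close>, then so
  does every ball of radius \<open>s < \<kappa>\<close>. Suppose the largest such radius \<open>\<tau>\<close> were smaller than \<open>s\<close>, and
  let \<open>c = a + \<tau> v\<close>. Reflecting the nearest point of \<open>z\<close> through \<open>c\<close> onto the sphere of radius \<open>\<rho>\<close>
  around \<open>c\<close> is a continuous self-map of a ball, so by Brouwer it has a fixed point \<open>z\<close>. For this \<open>z\<close>
  the centre \<open>c\<close> lies between \<open>z\<close> and its nearest point, which is therefore also the nearest point \<open>a\<close>
  of \<open>c\<close>. Thus \<open>z = a + (\<tau> + \<rho>) v\<close> projects to \<open>a\<close>, and \<open>\<tau>\<close> was not maximal.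
\<close>
lemma proj_radius_extends:
  assumes a: "a \<in> M" and v: "norm v = 1" and t0: "0 < t0"
    and near: "\<And>y. y \<in> M \<Longrightarrow> 2 * t0 * ((y - a) \<bullet> v) \<le> (norm (y - a))\<^sup>2"
    and s: "t0 \<le> s" "s < \<kappa>" and y: "y \<in> M"
  shows "2 * s * ((y - a) \<bullet> v) \<le> (norm (y - a))\<^sup>2"
proof -
  have nearest_iff: "(\<forall>y\<in>M. 2 * t * ((y - a) \<bullet> v) \<le> (norm (y - a))\<^sup>2) \<longleftrightarrow>
      (\<forall>y\<in>M. dist (a + t *\<^sub>R v) a \<le> dist (a + t *\<^sub>R v) y)" if "0 \<le> t" for t
    using nearest_iff_inner_le[of "t *\<^sub>R v" a] that v by (simp add: dist_norm mult.assoc)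
  define S where "S = {0..s} \<inter> (\<Inter>y\<in>M. {t. 2 * t * ((y - a) \<bullet> v) \<le> (norm (y - a))\<^sup>2})"
  have "compact S"
    unfolding S_def by (intro compact_Int_closed compact_Icc closed_INT ballI closed_Collect_le continuous_intros)
  moreover have "t0 \<in> S" using t0 s near by (auto simp: S_def)
  ultimately obtain \<tau> where \<tau>: "\<tau> \<in> S" and \<tau>_max: "\<And>t. t \<in> S \<Longrightarrow> t \<le> \<tau>"
    using compact_attains_sup[of S] by blast
  have "t0 \<le> \<tau>" using \<tau>_max \<open>t0 \<in> S\<close> by blast
  have "\<tau> = s"
  proof (rule ccontr)
    assume "\<tau> \<noteq> s"
    then have "\<tau> < s" using \<tau> by (auto simp: S_def)
    define c where "c = a + \<tau> *\<^sub>R v"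
    define \<rho> where "\<rho> = (s - \<tau>) / 2"
    have \<rho>: "0 < \<rho>" "\<tau> + \<rho> \<le> s" using \<open>\<tau> < s\<close> by (auto simp: \<rho>_def field_simps)
    have ca: "dist c a = \<tau>" using v \<open>t0 \<le> \<tau>\<close> t0 by (simp add: c_def dist_norm)
    have near_c: "\<forall>y\<in>M. dist c a \<le> dist c y"
      using nearest_iff[of \<tau>] \<tau> \<open>t0 \<le> \<tau>\<close> t0 by (auto simp: S_def c_def)
    have inf_c: "infdist c M = \<tau>"
      using near_c ca infdist_le[OF a, of c] dist_proj[of c] proj_in[of c] by force
    have proj_c: "proj c = a"
      using near_c a inf_c \<open>\<tau> < s\<close> s by (intro proj_eqI) auto
    have inf_ball: "infdist z M < \<kappa>" if "z \<in> cball c \<rho>" for z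
      using infdist_triangle[of z M c] that inf_c \<rho> s by (simp add: dist_commute)
    have "c \<noteq> proj z" for z
      using near_c proj_in[of z] ca \<open>t0 \<le> \<tau>\<close> t0 by force
    then have ne: "norm (c - proj z) \<noteq> 0" for z by simp
    \<comment> \<open>The map sends \<open>z\<close> to the point of the sphere around \<open>c\<close> opposite to the nearest point of \<open>z\<close>.\<close>
    define F where "F z = c + (\<rho> / norm (c - proj z)) *\<^sub>R (c - proj z)" for z
    have "continuous_on (cball c \<rho>) proj"
      using inf_ball by (intro continuous_on_subset[OF continuous_on_proj]) auto
    then have "continuous_on (cball c \<rho>) F"
      unfolding F_def using ne by (intro continuous_intros) auto
    moreover have F_dist: "dist c (F z) = \<rho>" for z
      using ne[of z] \<rho> by (simp add: F_def dist_norm)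
    ultimately obtain z where z: "z \<in> cball c \<rho>" "F z = z"
      using brouwer[of "cball c \<rho>" F] \<rho> by (auto simp: less_imp_le)
    define q where "q = proj z"
    have zc: "dist z c = \<rho>" using F_dist[of z] z by (simp add: dist_commute)
    have "z - q = (1 + \<rho> / norm (c - q)) *\<^sub>R (c - q)"
      using z(2) by (simp add: F_def q_def algebra_simps)
    then have "norm (z - q) = (1 + \<rho> / norm (c - q)) * norm (c - q)"
      using \<rho> by simp
    also have "\<dots> = norm (c - q) + \<rho>"
      using ne[of z] by (simp add: q_def field_simps)
    finally have zq: "dist z q = dist c q + \<rho>" by (simp add: dist_norm)
    have "dist c q \<le> dist c y" if "y \<in> M" for y
      using closest_point_le[OF closed_M that, of z] dist_triangle[of z y c] zq zc
      by (simp add: q_def)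
    then have "q = a"
      using proj_eqI[of c q] proj_c inf_c \<open>\<tau> < s\<close> s proj_in by (simp add: q_def)
    have "z = a + (\<tau> + \<rho>) *\<^sub>R v"
      using z(2) ca v \<open>t0 \<le> \<tau>\<close> t0 unfolding F_def q_def[symmetric] \<open>q = a\<close>
      by (simp add: c_def algebra_simps)
    moreover have "\<forall>y\<in>M. dist z a \<le> dist z y"
      using closest_point_le[OF closed_M, of _ z] \<open>q = a\<close> by (simp add: q_def)
    ultimately have "\<tau> + \<rho> \<in> S"
      using nearest_iff[of "\<tau> + \<rho>"] \<rho> \<open>t0 \<le> \<tau>\<close> t0 by (auto simp: S_def)
    then show False using \<tau>_max \<rho> by force
  qed
  then show ?thesis using \<tau> y by (auto simp: S_def)
qed

text \<open>
  A constant \<open>c\<close> for a unit vector means that a ball of radius \<open>1 / (2 c)\<close> touches \<open>M\<close> from outside.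
  Its radius extends to all \<open>s < \<kappa>\<close>, and \<open>s\<close> tends to \<open>\<kappa>\<close>.
\<close>
lemma proximal_normal_reach:
  assumes a: "a \<in> M" and v: "v \<in> proximal_normals M a" and y: "y \<in> M"
  shows "2 * \<kappa> * ((y - a) \<bullet> v) \<le> norm v * (norm (y - a))\<^sup>2"
proof (cases "(y - a) \<bullet> v \<le> 0")
  case True
  then have "2 * \<kappa> * ((y - a) \<bullet> v) \<le> 0" using \<kappa>_pos by (simp add: mult_nonneg_nonpos)
  also have "0 \<le> norm v * (norm (y - a))\<^sup>2" by simp
  finally show ?thesis .
next
  case False
  then have "v \<noteq> 0" by auto
  define u where "u = v /\<^sub>R norm v"
  have u: "norm u = 1" using \<open>v \<noteq> 0\<close> by (simp add: u_def)
  obtain c where c: "\<And>y. y \<in> M \<Longrightarrow> (y - a) \<bullet> v \<le> c * (norm (y - a))\<^sup>2"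
    using v by (auto simp: proximal_normals_def)
  define C where "C = max (c / norm v) (1 / \<kappa>)"
  have C: "0 < C" using \<kappa>_pos by (simp add: C_def less_max_iff_disj)
  have cu: "(z - a) \<bullet> u \<le> C * (norm (z - a))\<^sup>2" if "z \<in> M" for z
  proof -
    have "(z - a) \<bullet> u \<le> (c / norm v) * (norm (z - a))\<^sup>2"
      using c[OF that] \<open>v \<noteq> 0\<close> by (simp add: u_def divide_simps inner_commute)
    also have "\<dots> \<le> C * (norm (z - a))\<^sup>2" by (intro mult_right_mono) (auto simp: C_def)
    finally show ?thesis .
  qed
  define t0 where "t0 = 1 / (2 * C)"
  have t0: "0 < t0" "t0 < \<kappa>"
  proof -
    show "0 < t0" using C by (simp add: t0_def)
    have "1 / \<kappa> \<le> C" by (simp add: C_def)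
    then have "1 < \<kappa> * (2 * C)" using \<kappa>_pos by (simp add: field_simps)
    then show "t0 < \<kappa>" using C by (simp add: t0_def pos_divide_less_eq)
  qed
  have near: "2 * t0 * ((z - a) \<bullet> u) \<le> (norm (z - a))\<^sup>2" if "z \<in> M" for z
    using cu[OF that] C by (simp add: t0_def divide_simps mult.commute)
  have "2 * s * ((y - a) \<bullet> u) \<le> (norm (y - a))\<^sup>2" if "t0 < s" "s < \<kappa>" for s
    using proj_radius_extends[OF a u t0(1) near] that y by simp
  moreover have "((\<lambda>s. 2 * s * ((y - a) \<bullet> u)) \<longlongrightarrow> 2 * \<kappa> * ((y - a) \<bullet> u)) (at_left \<kappa>)"
    by (intro tendsto_intros)
  moreover have "eventually (\<lambda>s. t0 < s \<and> s < \<kappa>) (at_left \<kappa>)"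
    using eventually_at_left[OF t0(2)] t0(2) by auto
  ultimately have "2 * \<kappa> * ((y - a) \<bullet> u) \<le> (norm (y - a))\<^sup>2"
    by (intro tendsto_upperbound[where F = "at_left \<kappa>"]) (auto elim: eventually_mono)
  then show ?thesis using \<open>v \<noteq> 0\<close> by (simp add: u_def divide_simps mult.commute mult.left_commute)
qed

text \<open>
  The displacement from the nearest point is a proximal normal there.
\<close>
lemma proj_displacement_inner_le:
  assumes x: "infdist x M < \<kappa>" and y: "y \<in> M"
  shows "2 * \<kappa> * ((y - proj x) \<bullet> (x - proj x)) \<le> dist x (proj x) * (norm (y - proj x))\<^sup>2"
proof -
  have "(z - proj x) \<bullet> (x - proj x) \<le> 1/2 * (norm (z - proj x))\<^sup>2" if "z \<in> M" for z
    using nearest_iff_inner_le[of "x - proj x" "proj x" z] closest_point_le[OF closed_M that, of x]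
    by (simp add: dist_norm)
  then have "x - proj x \<in> proximal_normals M (proj x)" unfolding proximal_normals_def by blast
  from proximal_normal_reach[OF proj_in this y] show ?thesis by (simp add: dist_norm)
qed

text \<open>
  Adding the normal inequalities at the two foot points \<open>p\<close> and \<open>q\<close> bounds \<open>|p - q|\<^sup>2\<close> by
  \<open>(x - y) \<bullet> (p - q)\<close> plus \<open>|p - q|\<^sup>2 / 2\<close>; the last term is absorbed because both points are within
  \<open>\<kappa> / 2\<close> of \<open>M\<close>.
\<close>
lemma proj_lipschitz:
  assumes x: "infdist x M \<le> \<kappa> / 2" and y: "infdist y M \<le> \<kappa> / 2"
  shows "dist (proj x) (proj y) \<le> 2 * dist x y"
proof -
  let ?p = "proj x" and ?q = "proj y"
  have ix: "infdist x M < \<kappa>" and iy: "infdist y M < \<kappa>" using x y \<kappa>_pos by auto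
  have "2 * \<kappa> * ((?q - ?p) \<bullet> (x - ?p)) \<le> \<kappa> / 2 * (norm (?q - ?p))\<^sup>2"
    by (rule order_trans[OF proj_displacement_inner_le[OF ix proj_in]])
       (use x dist_proj[of x] in \<open>simp add: mult_right_mono del: times_divide_eq_left\<close>)
  then have 1: "(?q - ?p) \<bullet> (x - ?p) \<le> (norm (?q - ?p))\<^sup>2 / 4" using \<kappa>_pos by (simp add: field_simps)
  have "2 * \<kappa> * ((?p - ?q) \<bullet> (y - ?q)) \<le> \<kappa> / 2 * (norm (?p - ?q))\<^sup>2"
    by (rule order_trans[OF proj_displacement_inner_le[OF iy proj_in]])
       (use y dist_proj[of y] in \<open>simp add: mult_right_mono del: times_divide_eq_left\<close>)
  then have 2: "(?p - ?q) \<bullet> (y - ?q) \<le> (norm (?q - ?p))\<^sup>2 / 4"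
    using \<kappa>_pos by (simp add: field_simps norm_minus_commute)
  have "(?q - ?p) \<bullet> (x - ?p) + (?p - ?q) \<bullet> (y - ?q) = (norm (?q - ?p))\<^sup>2 - (?q - ?p) \<bullet> (y - x)"
    by (simp add: power2_norm_eq_inner inner_diff_left inner_diff_right inner_commute algebra_simps)
  with 1 2 have "(norm (?q - ?p))\<^sup>2 \<le> 2 * ((?q - ?p) \<bullet> (y - x))" by simp
  also have "\<dots> \<le> 2 * (norm (?q - ?p) * norm (y - x))" using norm_cauchy_schwarz by simp
  finally have "norm (?q - ?p) * norm (?q - ?p) \<le> norm (?q - ?p) * (2 * norm (y - x))"
    by (simp add: power2_eq_square)
  then show ?thesis by (cases "?q = ?p") (auto simp: dist_norm norm_minus_commute)
qed

lemma proj_add_proximal_normal: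
  assumes a: "a \<in> M" and v: "v \<in> proximal_normals M a" and small: "norm v < \<kappa>"
  shows "proj (a + v) = a" 
proof (rule proj_eqI[OF _ a])
  show "infdist (a + v) M < \<kappa>" using infdist_le[OF a, of "a + v"] small by (simp add: dist_norm)
  fix y assume y: "y \<in> M"
  have "2 * ((y - a) \<bullet> v) \<le> (norm (y - a))\<^sup>2"
  proof -
    have "\<kappa> * (2 * ((y - a) \<bullet> v)) \<le> norm v * (norm (y - a))\<^sup>2"
      using proximal_normal_reach[OF a v y] by (simp add: mult_ac)
    also have "\<dots> \<le> \<kappa> * (norm (y - a))\<^sup>2" using small by (intro mult_right_mono) auto
    finally show ?thesis using \<kappa>_pos by simp
  qed
  then show "dist (a + v) a \<le> dist (a + v) y" using nearest_iff_inner_le[of v a y] by (simp add: dist_norm)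
qed

end

section \<open>Proximal normals of a smooth submanifold\<close>

lemma differentiable_imp_pointwise_lipschitz:
  fixes f :: "'a::real_normed_vector \<Rightarrow> 'b::real_normed_vector"
  assumes "f differentiable (at x)"
  obtains C \<delta> where "0 \<le> C" "0 < \<delta>" "\<And>y. norm (y - x) < \<delta> \<Longrightarrow> norm (f y - f x) \<le> C * norm (y - x)"
proof -
  obtain f' where f': "(f has_derivative f') (at x)" using assms by (auto simp: differentiable_def)
  then have bl: "bounded_linear f'" by (rule has_derivative_bounded_linear)
  obtain \<delta> where \<delta>: "0 < \<delta>" "\<And>y. norm (y - x) < \<delta> \<Longrightarrow> norm (f y - f x - f' (y - x)) \<le> 1 * norm (y - x)"
    using f' unfolding has_derivative_at_alt by (meson zero_less_one)
  show ?thesis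
  proof (rule that[of "1 + onorm f'" \<delta>])
    show "0 \<le> 1 + onorm f'" using onorm_pos_le[OF bl] by simp
    fix y assume y: "norm (y - x) < \<delta>"
    have "norm (f y - f x) \<le> norm (f y - f x - f' (y - x)) + norm (f' (y - x))"
      by (metis diff_add_cancel norm_triangle_ineq)
    also have "\<dots> \<le> (1 + onorm f') * norm (y - x)"
      using \<delta>(2)[OF y] onorm[OF bl, of "y - x"] by (simp add: algebra_simps)
    finally show "norm (f y - f x) \<le> (1 + onorm f') * norm (y - x)" .
  qed (fact \<delta>(1))
qed

text \<open>
  Near \<open>a\<close> the derivative of \<open>f\<close> differs from its value at \<open>a\<close> by \<open>O(|x - a|)\<close> in operator norm, as
  each of its finitely many values on basis vectors is differentiable at \<open>a\<close>. The mean value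
  inequality on the ball of radius \<open>|x - a|\<close> then gives the quadratic remainder.
\<close>
lemma second_order_remainder:
  fixes f :: "'a::euclidean_space \<Rightarrow> 'b::real_normed_vector"
  assumes V: "open V" "a \<in> V"
    and f: "\<And>x. x \<in> V \<Longrightarrow> f differentiable (at x)"
    and f2: "\<And>v. (\<lambda>x. frechet_derivative f (at x) v) differentiable (at a)"
  obtains C \<delta> where "0 \<le> C" "0 < \<delta>"
    "\<And>x. norm (x - a) < \<delta> \<Longrightarrow>
       norm (f x - f a - frechet_derivative f (at a) (x - a)) \<le> C * (norm (x - a))\<^sup>2"
proof -
  let ?D = "\<lambda>x. frechet_derivative f (at x)"
  have der: "(f has_derivative ?D x) (at x)" if "x \<in> V" for x
    using f[OF that] by (simp add: frechet_derivative_works[symmetric])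
  have "\<exists>C \<delta>. 0 \<le> C \<and> 0 < \<delta> \<and> (\<forall>x. norm (x - a) < \<delta> \<longrightarrow> norm (?D x b - ?D a b) \<le> C * norm (x - a))" for b
    using differentiable_imp_pointwise_lipschitz[OF f2[of b]] by metis
  then obtain C \<delta> where C: "\<And>b. 0 \<le> C b" and \<delta>: "\<And>b. 0 < \<delta> b"
    and CD: "\<And>b x. norm (x - a) < \<delta> b \<Longrightarrow> norm (?D x b - ?D a b) \<le> C b * norm (x - a)"
    by metis
  obtain r where r: "0 < r" "ball a r \<subseteq> V" using V open_contains_ball by blast
  define \<epsilon> where "\<epsilon> = Min (insert r (\<delta> ` Basis))"
  have \<epsilon>: "0 < \<epsilon>" "\<epsilon> \<le> r" "\<And>b. b \<in> Basis \<Longrightarrow> \<epsilon> \<le> \<delta> b"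
    using \<delta> r by (auto simp: \<epsilon>_def min_le_iff_disj)
  define B where "B = (\<Sum>b\<in>Basis. C b)"
  show ?thesis
  proof (rule that[of B \<epsilon>])
    show "0 \<le> B" using C by (simp add: B_def sum_nonneg)
    fix x assume x: "norm (x - a) < \<epsilon>"
    let ?S = "cball a (norm (x - a))"
    have SV: "?S \<subseteq> V" using x \<epsilon> r by (force simp: dist_norm norm_minus_commute)
    have on: "onorm (\<lambda>h. ?D z h - ?D a h) \<le> B * norm (x - a)" if z: "z \<in> ?S" for z
    proof (rule onorm_le)
      fix h :: 'a
      have lin: "linear (\<lambda>h. ?D z h - ?D a h)"
        using der[of z] der[of a] SV z V
        by (intro linear_compose_sub bounded_linear.linear has_derivative_bounded_linear) auto
      have "?D z h - ?D a h = (\<Sum>b\<in>Basis. (h \<bullet> b) *\<^sub>R (?D z b - ?D a b))"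
        using linear_sum[OF lin, of "\<lambda>b. (h \<bullet> b) *\<^sub>R b" Basis]
        by (simp add: euclidean_representation linear_scale[OF lin])
      also have "norm \<dots> \<le> (\<Sum>b\<in>Basis. norm h * (C b * norm (x - a)))"
      proof (intro sum_norm_le)
        fix b :: 'a assume b: "b \<in> Basis"
        have nz: "norm (z - a) \<le> norm (x - a)" using z by (simp add: dist_norm norm_minus_commute)
        then have "norm (?D z b - ?D a b) \<le> C b * norm (z - a)"
          using x \<epsilon>(3)[OF b] by (intro CD) auto
        also have "\<dots> \<le> C b * norm (x - a)" using nz C by (intro mult_left_mono) auto
        finally show "norm ((h \<bullet> b) *\<^sub>R (?D z b - ?D a b)) \<le> norm h * (C b * norm (x - a))"
          using Basis_le_norm[OF b, of h] by (simp add: mult_mono)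
      qed
      also have "\<dots> = B * norm (x - a) * norm h"
        by (simp add: B_def sum_distrib_right sum_distrib_left mult_ac)
      finally show "norm (?D z h - ?D a h) \<le> B * norm (x - a) * norm h" .
    qed
    have seg: "a + t *\<^sub>R (x - a) \<in> ?S" if "t \<in> {0..1}" for t
      using that by (simp add: dist_norm mult_left_le_one_le)
    have "norm (f x - f a - ?D a (x - a)) \<le> norm (x - a) * (B * norm (x - a))"
    proof (rule differentiable_bound_linearization[where S = ?S])
      show "(f has_derivative ?D z) (at z within ?S)" if "z \<in> ?S" for z
        using der SV that by (meson has_derivative_at_withinI subsetD)
      show "onorm (?D z - ?D a) \<le> B * norm (x - a)" if "z \<in> ?S" for z
        using on[OF that] by (simp add: fun_diff_def)
    qed (use seg in auto)
    then show "norm (f x - f a - ?D a (x - a)) \<le> B * (norm (x - a))\<^sup>2"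
      by (simp add: power2_eq_square mult_ac)
  qed (fact \<epsilon>(1))
qed

text \<open>
  The space \<open>T\<close> is the tangent space, the image of the model subspace under the derivative of the
  inverse chart \<open>\<psi>\<close>. A proximal normal \<open>v\<close> is orthogonal to \<open>T\<close>: along the curve
  \<open>t \<mapsto> \<psi> (a + t h)\<close> in \<open>M\<close> the defining inequality says that a function with derivative
  \<open>D\<psi> h \<bullet> v\<close> at \<open>0\<close> has a local maximum there. Conversely, if \<open>v\<close> is orthogonal to \<open>T\<close>, then near
  \<open>x\<close> the inner product \<open>(y - x) \<bullet> v\<close> sees only the second-order remainder of \<open>\<psi>\<close>, and away from
  \<open>x\<close> the quadratic bound is trivial.
\<close>
lemma proximal_normals_smooth_submanifold:
  assumes M: "smooth_submanifold d M" and x: "x \<in> M"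
  obtains T where "subspace T" "dim T = d" "proximal_normals M x = T\<^sup>\<bottom>"
proof -
  obtain U V S :: "'a set" and \<phi> \<psi> where chart: "open U" "x \<in> U" "open V"
      "homeomorphism U V \<phi> \<psi>" "smooth_on U \<phi>" "smooth_on V \<psi>" "subspace S" "dim S = d"
      "\<phi> ` (M \<inter> U) = S \<inter> V"
    using M x unfolding smooth_submanifold_def by metis
  define a where "a = \<phi> x"
  have a: "a \<in> S" "a \<in> V" "\<psi> a = x"
    using chart x by (auto simp: a_def homeomorphism_def)
  have \<psi>_diff: "\<psi> differentiable (at z)" if "z \<in> V" for z
    using chart(6) that unfolding smooth_on_def by (metis Ck_on.simps(2))
  have \<phi>_diff: "\<phi> differentiable (at z)" if "z \<in> U" for z
    using chart(5) that unfolding smooth_on_def by (metis Ck_on.simps(2))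
  have \<psi>2: "(\<lambda>z. frechet_derivative \<psi> (at z) v) differentiable (at a)" for v
  proof -
    have "Ck_on (Suc (Suc 0)) V \<psi>" using chart(6) unfolding smooth_on_def by blast
    then have "Ck_on (Suc 0) V (\<lambda>z. frechet_derivative \<psi> (at z) v)" by (simp del: Ck_on.simps(1))
    then show ?thesis using a(2) by simp
  qed
  let ?D = "frechet_derivative \<psi> (at a)" and ?E = "frechet_derivative \<phi> (at x)"
  have D: "(\<psi> has_derivative ?D) (at a)" using \<psi>_diff[OF a(2)] by (simp add: frechet_derivative_works[symmetric])
  have E: "(\<phi> has_derivative ?E) (at x)" using \<phi>_diff[OF chart(2)] by (simp add: frechet_derivative_works[symmetric])
  have linD: "linear ?D" using D has_derivative_bounded_linear bounded_linear.linear by blast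
  have "((\<phi> \<circ> \<psi>) has_derivative (?E \<circ> ?D)) (at a)"
    using D E a(3) by (intro diff_chain_at) auto
  moreover have "((\<phi> \<circ> \<psi>) has_derivative id) (at a)"
  proof (rule has_derivative_transform_within_open[OF has_derivative_id chart(3) a(2)])
    show "id z = (\<phi> \<circ> \<psi>) z" if "z \<in> V" for z
      using chart(4) that by (simp add: homeomorphism_def)
  qed
  ultimately have ED: "?E \<circ> ?D = id" by (rule has_derivative_unique)
  have inj: "inj ?D" using ED by (metis inj_on_id inj_on_imageI2)
  define T where "T = ?D ` S"
  have T: "subspace T" "dim T = d"
    using linear_subspace_image[OF linD chart(7)] dim_image_eq[OF linD, of S] inj chart(8)
    by (auto simp: T_def intro: inj_on_subset)
  have "v \<in> T\<^sup>\<bottom>" if v: "v \<in> proximal_normals M x" for v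
  proof -
    obtain c where c: "\<And>y. y \<in> M \<Longrightarrow> (y - x) \<bullet> v \<le> c * (norm (y - x))\<^sup>2"
      using v by (auto simp: proximal_normals_def)
    have "?D h \<bullet> v = 0" if h: "h \<in> S" for h
    proof -
      \<comment> \<open>\<open>g \<le> 0 = g 0\<close> near \<open>0\<close>, and the quadratic term does not contribute to \<open>g' 0\<close>.\<close>
      define g where "g t = (\<psi> (a + t *\<^sub>R h) - x) \<bullet> v - c * (norm (\<psi> (a + t *\<^sub>R h) - x))\<^sup>2" for t
      have curve: "((\<lambda>t. \<psi> (a + t *\<^sub>R h)) has_derivative (\<lambda>t. ?D (t *\<^sub>R h))) (at 0)"
      proof -
        have "((\<lambda>t. a + t *\<^sub>R h) has_derivative (\<lambda>t. t *\<^sub>R h)) (at 0)"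
          by (auto intro!: derivative_eq_intros)
        then show ?thesis
          using diff_chain_at[of "\<lambda>t. a + t *\<^sub>R h" "\<lambda>t. t *\<^sub>R h" 0 \<psi> ?D] D by (simp add: o_def)
      qed
      have "(g has_derivative (\<lambda>t. ?D (t *\<^sub>R h) \<bullet> v)) (at 0)"
        unfolding g_def power2_norm_eq_inner
        by (rule derivative_eq_intros curve refl)+ (use a(3) in \<open>auto simp: fun_eq_iff\<close>)
      then have "(g has_real_derivative (?D h \<bullet> v)) (at 0)"
        by (simp add: has_field_derivative_def linear_scale[OF linD] mult_commute_abs)
      moreover obtain \<delta> where \<delta>: "0 < \<delta>" "\<And>t. \<bar>0 - t\<bar> < \<delta> \<Longrightarrow> a + t *\<^sub>R h \<in> V"
      proof -
        have "open ((\<lambda>t. a + t *\<^sub>R h) -` V)"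
          by (intro continuous_open_vimage chart(3)) (auto intro!: continuous_intros)
        moreover have "0 \<in> (\<lambda>t. a + t *\<^sub>R h) -` V" using a by simp
        ultimately obtain e where "0 < e" "ball 0 e \<subseteq> (\<lambda>t. a + t *\<^sub>R h) -` V"
          using open_contains_ball by blast
        then show ?thesis by (intro that[of e]) (force simp: dist_real_def subset_iff)+
      qed
      moreover have "g t \<le> g 0" if "\<bar>0 - t\<bar> < \<delta>" for t
      proof -
        have "a + t *\<^sub>R h \<in> S \<inter> V"
          using \<delta>(2)[OF that] a(1) h chart(7) by (simp add: subspace_add subspace_scale)
        then have "a + t *\<^sub>R h \<in> \<phi> ` (M \<inter> U)" by (simp only: chart(9))
        then obtain y where y: "y \<in> M" "y \<in> U" "a + t *\<^sub>R h = \<phi> y" by blast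
        have "\<psi> (a + t *\<^sub>R h) \<in> M"
          unfolding y(3) homeomorphism_apply1[OF chart(4) y(2)] by (rule y(1))
        from c[OF this] show ?thesis using a(3) by (simp add: g_def)
      qed
      ultimately show ?thesis by (intro DERIV_local_max[of g _ 0 \<delta>]) auto
    qed
    then show ?thesis by (auto simp: T_def orthogonal_comp_def orthogonal_def)
  qed
  moreover have "v \<in> proximal_normals M x" if v: "v \<in> T\<^sup>\<bottom>" for v
  proof -
    obtain C \<delta>1 where C: "0 \<le> C" "0 < \<delta>1"
      "\<And>s. norm (s - a) < \<delta>1 \<Longrightarrow> norm (\<psi> s - \<psi> a - ?D (s - a)) \<le> C * (norm (s - a))\<^sup>2"
      using second_order_remainder[OF chart(3) a(2) \<psi>_diff \<psi>2] by blast
    obtain L \<delta>2 where L: "0 \<le> L" "0 < \<delta>2"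
      "\<And>y. norm (y - x) < \<delta>2 \<Longrightarrow> norm (\<phi> y - \<phi> x) \<le> L * norm (y - x)"
      using differentiable_imp_pointwise_lipschitz[OF \<phi>_diff[OF chart(2)]] by metis
    obtain r where r: "0 < r" "ball x r \<subseteq> U" using chart open_contains_ball by blast
    define \<delta> where "\<delta> = Min {\<delta>2, r, \<delta>1 / (L + 1)}"
    have \<delta>: "0 < \<delta>" "\<delta> \<le> \<delta>2" "\<delta> \<le> r" "\<delta> \<le> \<delta>1 / (L + 1)"
      using C L r by (auto simp: \<delta>_def)
    define c where "c = norm v * C * L\<^sup>2 + norm v / \<delta>"
    have "(y - x) \<bullet> v \<le> c * (norm (y - x))\<^sup>2" if y: "y \<in> M" for y
    proof (cases "norm (y - x) < \<delta>")
      case True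
      then have yU: "y \<in> U" using r \<delta> by (auto simp: dist_norm norm_minus_commute)
      define s where "s = \<phi> y"
      have s: "s \<in> S" "\<psi> s = y"
        using chart(4,9) y yU by (auto simp: s_def homeomorphism_def)
      have sa: "norm (s - a) \<le> L * norm (y - x)" using L(3) True \<delta> by (simp add: s_def a_def)
      also have "\<dots> \<le> L * (\<delta>1 / (L + 1))" using True \<delta> L by (intro mult_left_mono) auto
      also have "\<dots> < \<delta>1" using L C by (simp add: field_simps)
      finally have small: "norm (s - a) < \<delta>1" .
      have "?D (s - a) \<in> T" using s a chart(7) by (auto simp: T_def subspace_diff)
      then have "?D (s - a) \<bullet> v = 0" using v by (auto simp: orthogonal_comp_def orthogonal_def)
      then have "(y - x) \<bullet> v = (\<psi> s - \<psi> a - ?D (s - a)) \<bullet> v"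
        using s a by (simp add: inner_diff_left)
      also have "\<dots> \<le> norm (\<psi> s - \<psi> a - ?D (s - a)) * norm v" by (rule norm_cauchy_schwarz)
      also have "\<dots> \<le> (C * (norm (s - a))\<^sup>2) * norm v" by (intro mult_right_mono C(3) small) auto
      also have "\<dots> \<le> (C * (L * norm (y - x))\<^sup>2) * norm v"
        using sa C by (intro mult_right_mono mult_left_mono power_mono) auto
      also have "\<dots> = norm v * C * L\<^sup>2 * (norm (y - x))\<^sup>2" by (simp add: power_mult_distrib)
      also have "\<dots> \<le> c * (norm (y - x))\<^sup>2"
        using \<delta> by (intro mult_right_mono) (auto simp: c_def)
      finally show ?thesis .
    next
      case False
      have "(y - x) \<bullet> v \<le> norm v * norm (y - x)" using norm_cauchy_schwarz[of "y - x" v] by (simp add: mult.commute)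
      also have "\<dots> \<le> norm v * (norm (y - x) * (norm (y - x) / \<delta>))"
        using False \<delta> by (intro mult_left_mono) (auto simp: pos_le_divide_eq intro!: mult_left_mono)
      also have "\<dots> = norm v / \<delta> * (norm (y - x))\<^sup>2" by (simp add: power2_eq_square)
      also have "\<dots> \<le> c * (norm (y - x))\<^sup>2"
        using C by (intro mult_right_mono) (auto simp: c_def)
      finally show ?thesis .
    qed
    then show ?thesis unfolding proximal_normals_def by blast
  qed
  ultimately show ?thesis using that T by blast
qed

section \<open>Orthonormal systems\<close>

definition coord_proj :: "'a::real_inner set \<Rightarrow> 'a \<Rightarrow> 'a" where
  "coord_proj E v = (\<Sum>e\<in>E. (v \<bullet> e) *\<^sub>R e)"

locale orthonormal =
  fixes E :: "'a::euclidean_space set"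
  assumes finite_E: "finite E"
    and inner_E: "\<And>e e'. e \<in> E \<Longrightarrow> e' \<in> E \<Longrightarrow> e \<bullet> e' = (if e = e' then 1 else 0)"
begin

lemma norm_E: "e \<in> E \<Longrightarrow> norm e = 1"
  using inner_E[of e e] by (simp add: norm_eq_1)

lemma inner_sum_E:
  assumes "e \<in> E"
  shows "(\<Sum>e'\<in>E. c e' *\<^sub>R e') \<bullet> e = c e"
proof -
  have "(\<Sum>e'\<in>E. c e' *\<^sub>R e') \<bullet> e = (\<Sum>e'\<in>E. if e' = e then c e else 0)"
    unfolding inner_sum_left using inner_E assms by (intro sum.cong) auto
  then show ?thesis using assms finite_E by simp
qed

lemma coord_proj_in_span: "coord_proj E v \<in> span E"
  unfolding coord_proj_def by (intro span_sum span_scale span_base)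

lemma inner_coord_proj:
  assumes "u \<in> span E"
  shows "coord_proj E v \<bullet> u = v \<bullet> u"
proof -
  have "orthogonal (v - coord_proj E v) u"
  proof (rule orthogonal_to_span[OF assms])
    show "orthogonal (v - coord_proj E v) e" if "e \<in> E" for e
      using inner_sum_E[OF that] by (simp add: orthogonal_def inner_diff_left coord_proj_def)
  qed
  then show ?thesis by (simp add: orthogonal_def inner_diff_left)
qed

lemma coord_proj_ident:
  assumes "u \<in> span E"
  shows "coord_proj E u = u"
proof -
  have "u - coord_proj E u \<in> span E" using assms coord_proj_in_span by (intro span_diff)
  then have "(u - coord_proj E u) \<bullet> (u - coord_proj E u) = 0"
    using inner_coord_proj[of "u - coord_proj E u" u] by (simp add: inner_diff_left)
  then show ?thesis by simp
qed

lemma continuous_coord_proj: "continuous_on A (\<lambda>y. coord_proj E (y - x))"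
  unfolding coord_proj_def by (intro continuous_intros)

lemma coord_proj_diff: "coord_proj E (u - v) = coord_proj E u - coord_proj E v"
  by (simp add: coord_proj_def inner_diff_left scaleR_left_diff_distrib sum_subtractf)

lemma norm_coord_proj_le: "norm (coord_proj E v) \<le> norm v"
proof -
  have "norm (coord_proj E v) * norm (coord_proj E v) \<le> norm v * norm (coord_proj E v)"
    using inner_coord_proj[OF coord_proj_in_span, of v v] norm_cauchy_schwarz[of v "coord_proj E v"]
    by (simp add: dot_square_norm power2_eq_square)
  then show ?thesis by (cases "coord_proj E v = 0") auto
qed

end

lemma orthonormal_basis_exists:
  fixes S :: "'a::euclidean_space set"
  assumes "subspace S"
  obtains E where "orthonormal E" "card E = dim S" "span E = S"
proof -
  obtain E where E: "pairwise orthogonal E" "\<And>x. x \<in> E \<Longrightarrow> norm x = 1"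
     "independent E" "card E = dim S" "span E = S"
    using orthonormal_basis_subspace[OF assms] by metis
  have "orthonormal E"
  proof
    show "finite E" using E(3) independent_imp_finite by blast
    show "e \<bullet> e' = (if e = e' then 1 else 0)" if "e \<in> E" "e' \<in> E" for e e'
      using E(1,2) that norm_eq_1 by (auto simp: pairwise_def orthogonal_def)
  qed
  then show ?thesis using that E(4,5) by blast
qed

section \<open>Stability of manifolds of positive reach\<close>

text \<open>
  Smoothness and dimension enter only through the normal spaces.
\<close>
locale reach_manifold = positive_reach M \<kappa> for M :: "'a::euclidean_space set" and \<kappa> +
  fixes d :: nat
  assumes normal_space:
    "\<And>x. x \<in> M \<Longrightarrow> \<exists>T. subspace T \<and> dim T = d \<and> proximal_normals M x = T\<^sup>\<bottom>"
begin

lemma uminus_proximal_normal: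
  assumes "x \<in> M" "v \<in> proximal_normals M x"
  shows "- v \<in> proximal_normals M x"
  using normal_space[OF assms(1)] assms(2) subspace_neg[OF subspace_orthogonal_comp] by metis

lemma proximal_normal_abs_le:
  assumes "x \<in> M" "v \<in> proximal_normals M x" "y \<in> M"
  shows "2 * \<kappa> * \<bar>(y - x) \<bullet> v\<bar> \<le> norm v * (norm (y - x))\<^sup>2"
  using proximal_normal_reach[OF assms]
    proximal_normal_reach[OF assms(1) uminus_proximal_normal[OF assms(1,2)] assms(3)]
  by (simp add: abs_if)

text \<open>
  Let \<open>p\<close> maximise the distance to \<open>M'\<close> over \<open>M\<close>, with maximum \<open>h\<close>, nearest point \<open>q\<close> on \<open>M'\<close> and
  unit direction \<open>u = (p - q) / h\<close>. Since \<open>u\<close> is normal to \<open>M'\<close> at \<open>q\<close> and the projection to \<open>M'\<close> is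
  Lipschitz, the distance of any \<open>y \<in> M\<close> to \<open>M'\<close> is at least
  \<open>h + (y - p) \<bullet> u - 2 |y - p|\<^sup>2 / \<kappa>\<close>. As it is also at most \<open>h\<close>, the vector \<open>u\<close> is a proximal
  normal of \<open>M\<close> at \<open>p\<close>, hence so is \<open>-u\<close>, and the linear term is at least \<open>-|y - p|\<^sup>2 / (2 \<kappa>)\<close>.
  Taking for \<open>y\<close> the point of the net near \<open>p\<close> bounds \<open>h\<close>.
\<close>
lemma infdist_le_of_near_net:
  fixes M' :: "'a set"
  assumes M': "positive_reach M' \<kappa>"
    and net: "\<And>x. x \<in> M \<Longrightarrow> \<exists>z\<in>M. dist x z \<le> \<rho> \<and> infdist z M' \<le> \<eta>"
    and small: "\<rho> + \<eta> \<le> \<kappa> / 2" and x: "x \<in> M"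
  shows "infdist x M' \<le> \<eta> + 5 / (2 * \<kappa>) * \<rho>\<^sup>2"
proof -
  interpret M': positive_reach M' \<kappa> by fact
  obtain p where p: "p \<in> M" and p_max: "\<And>z. z \<in> M \<Longrightarrow> infdist z M' \<le> infdist p M'"
  proof -
    have "continuous_on M (\<lambda>z. infdist z M')" by (intro continuous_intros)
    from continuous_attains_sup[OF compact_M M_nonempty this] that show ?thesis by blast
  qed
  define h where "h = infdist p M'"
  obtain z where z: "z \<in> M" "dist p z \<le> \<rho>" "infdist z M' \<le> \<eta>" using net[OF p] by blast
  have "h \<le> \<kappa> / 2"
    using infdist_triangle[of p M' z] z small by (simp add: h_def dist_commute)
  then have tube: "infdist y M' \<le> \<kappa> / 2" if "y \<in> M" for y using p_max[OF that] by (simp add: h_def)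
  have "h \<le> \<eta> + 5 / (2 * \<kappa>) * \<rho>\<^sup>2"
  proof (cases "h = 0")
    case True
    then show ?thesis using infdist_nonneg[of z M'] z(3) \<kappa>_pos by simp
  next
    case False
    then have h: "0 < h" using infdist_nonneg[of p M'] by (simp add: h_def)
    define q where "q = M'.proj p"
    define u where "u = (p - q) /\<^sub>R h"
    have pq: "norm (p - q) = h" using M'.dist_proj[of p] by (simp add: q_def h_def dist_norm)
    then have u: "norm u = 1" "(p - q) \<bullet> u = h"
      using h by (auto simp: u_def dot_square_norm power2_eq_square)
    have lower: "h + (y - p) \<bullet> u - 2 / \<kappa> * (norm (y - p))\<^sup>2 \<le> infdist y M'" if y: "y \<in> M" for y
    proof -
      define q' where "q' = M'.proj y"
      have "2 * \<kappa> * ((q' - q) \<bullet> (p - q)) \<le> h * (norm (q' - q))\<^sup>2"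
        using M'.proj_displacement_inner_le[of p q'] tube[OF p] \<kappa>_pos M'.proj_in M'.dist_proj[of p]
        by (simp add: q_def q'_def h_def)
      moreover have "(q' - q) \<bullet> (p - q) = h * ((q' - q) \<bullet> u)" using h by (simp add: u_def)
      ultimately have "h * (2 * \<kappa> * ((q' - q) \<bullet> u)) \<le> h * (norm (q' - q))\<^sup>2" by (simp add: mult_ac)
      then have "2 * \<kappa> * ((q' - q) \<bullet> u) \<le> (norm (q' - q))\<^sup>2" using h by simp
      also have "\<dots> \<le> (2 * norm (y - p))\<^sup>2"
        using M'.proj_lipschitz[OF tube[OF y] tube[OF p]]
        by (intro power_mono) (simp_all add: q_def q'_def dist_norm)
      finally have "(q' - q) \<bullet> u \<le> 2 / \<kappa> * (norm (y - p))\<^sup>2"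
        using \<kappa>_pos by (simp add: field_simps power_mult_distrib)
      moreover have "h + (y - p) \<bullet> u - (q' - q) \<bullet> u = (y - q') \<bullet> u"
        unfolding u(2)[symmetric] by (simp add: inner_diff_left)
      moreover have "(y - q') \<bullet> u \<le> infdist y M'"
        using norm_cauchy_schwarz[of "y - q'" u] u M'.dist_proj[of y] by (simp add: q'_def dist_norm)
      ultimately show ?thesis by linarith
    qed
    have "u \<in> proximal_normals M p"
      unfolding proximal_normals_def
      using lower p_max by (intro CollectI exI[of _ "2 / \<kappa>"] ballI) (force simp: h_def)
    then have "2 * \<kappa> * \<bar>(z - p) \<bullet> u\<bar> \<le> (norm (z - p))\<^sup>2"
      using proximal_normal_abs_le[OF p _ z(1), of u] u(1) by simp
    then have "\<bar>(z - p) \<bullet> u\<bar> \<le> (norm (z - p))\<^sup>2 / (2 * \<kappa>)"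
      using \<kappa>_pos by (simp add: pos_le_divide_eq mult_ac)
    then have "- ((z - p) \<bullet> u) \<le> (norm (z - p))\<^sup>2 / (2 * \<kappa>)" by linarith
    then have "h \<le> infdist z M' + ((norm (z - p))\<^sup>2 / (2 * \<kappa>) + 2 / \<kappa> * (norm (z - p))\<^sup>2)"
      using lower[OF z(1)] by linarith
    also have "(norm (z - p))\<^sup>2 / (2 * \<kappa>) + 2 / \<kappa> * (norm (z - p))\<^sup>2 = 5 / (2 * \<kappa>) * (norm (z - p))\<^sup>2"
      using \<kappa>_pos by (simp add: field_simps)
    also have "\<dots> \<le> 5 / (2 * \<kappa>) * \<rho>\<^sup>2"
      using z(2) \<kappa>_pos by (intro mult_left_mono power_mono) (auto simp: dist_norm norm_minus_commute)
    finally show ?thesis using z(3) by simp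
  qed
  then show ?thesis using p_max[OF x] by (simp add: h_def)
qed

end

section \<open>Packing and covering numbers\<close>

text \<open>
  The ratio of the volume of the ball of radius \<open>R + \<kappa>\<close> to the total volume of the disjoint balls
  placed in the normal fibre over one point of \<open>M\<close>, with the power of the separation \<open>\<delta>\<close>
  removed. It depends on \<open>M\<close> only through \<open>d\<close>, \<open>\<kappa>\<close> and \<open>R\<close>, which makes the estimates below uniform
  over the class.
\<close>
definition packing_bound :: "nat \<Rightarrow> nat \<Rightarrow> real \<Rightarrow> real \<Rightarrow> real" where
  "packing_bound D d \<kappa> R = (4 * (R + \<kappa>)) ^ D * (4 * real D / \<kappa>) ^ (D - d)"

context reach_manifold
begin

lemma orthonormal_normal_basis:
  assumes x: "x \<in> M"
  obtains E where "orthonormal E" "card E = DIM('a) - d" "span E = proximal_normals M x"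
proof -
  obtain T where T: "subspace T" "dim T = d" "proximal_normals M x = T\<^sup>\<bottom>"
    using normal_space[OF x] by blast
  have "dim (T\<^sup>\<bottom>) + dim T = DIM('a)"
    using dim_subspace_orthogonal_to_vectors[OF T(1) subspace_UNIV]
    by (simp add: orthogonal_comp_def)
  then have "dim (T\<^sup>\<bottom>) = DIM('a) - d" using T by simp
  moreover obtain E where "orthonormal E" "card E = dim (T\<^sup>\<bottom>)" "span E = T\<^sup>\<bottom>"
    by (rule orthonormal_basis_exists[OF subspace_orthogonal_comp[of T]])
  ultimately show ?thesis using that[of E] T by simp
qed

text \<open>
  The multiples of \<open>\<delta>\<close> in orthonormal coordinates of the normal space, cut off so that the
  norm stays below \<open>\<kappa> / 4\<close>.
\<close>
lemma normal_grid:
  fixes \<delta> :: real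
  assumes x: "x \<in> M" and \<delta>: "0 < \<delta>" 
  obtains G where "finite G" "G \<subseteq> proximal_normals M x"
    "\<And>v. v \<in> G \<Longrightarrow> norm v \<le> \<kappa> / 4"
    "\<And>v w. v \<in> G \<Longrightarrow> w \<in> G \<Longrightarrow> v \<noteq> w \<Longrightarrow> \<delta> \<le> dist v w"
    "(\<kappa> / (4 * real DIM('a) * \<delta>)) ^ (DIM('a) - d) \<le> real (card G)"
proof -
  obtain E where E: "orthonormal E" "card E = DIM('a) - d" "span E = proximal_normals M x"
    by (rule orthonormal_normal_basis[OF x])
  interpret orthonormal E by fact
  define q where "q = \<kappa> / (4 * real DIM('a) * \<delta>)"
  have q: "0 \<le> q" using \<kappa>_pos \<delta> by (simp add: q_def)
  define m where "m = nat \<lfloor>q\<rfloor>"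
  have m: "real m \<le> q" "q \<le> real (Suc m)" using q by (auto simp: m_def) linarith
  define A where "A = (PiE E (\<lambda>_. {..m}))"
  define v where "v k = (\<Sum>e\<in>E. (\<delta> * real (k e)) *\<^sub>R e)" for k :: "'a \<Rightarrow> nat"
  have inner_v: "v k \<bullet> e = \<delta> * real (k e)" if "e \<in> E" for k e
    unfolding v_def by (rule inner_sum_E[OF that])
  have sep: "\<delta> \<le> dist (v k) (v l)" if kl: "k \<in> A" "l \<in> A" "k \<noteq> l" for k l
  proof -
    obtain e where e: "e \<in> E" "k e \<noteq> l e" using kl PiE_ext[of k E _ l] unfolding A_def by blast
    have "1 \<le> \<bar>real (k e) - real (l e)\<bar>" using e(2) by linarith
    then have "\<delta> \<le> \<delta> * \<bar>real (k e) - real (l e)\<bar>" using \<delta> by simp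
    also have "\<dots> = \<bar>(v k - v l) \<bullet> e\<bar>"
      using \<delta> e by (simp add: inner_diff_left inner_v abs_mult flip: right_diff_distrib)
    also have "\<dots> \<le> norm (v k - v l) * norm e" by (rule Cauchy_Schwarz_ineq2)
    also have "norm e = 1" by (rule norm_E[OF e(1)])
    finally show ?thesis by (simp add: dist_norm)
  qed
  then have inj: "inj_on v A" using \<delta> by (force simp: inj_on_def)
  show ?thesis
  proof (rule that[of "v ` A"])
    show "finite (v ` A)" using finite_E by (simp add: A_def finite_PiE)
    show "v ` A \<subseteq> proximal_normals M x"
      unfolding E(3)[symmetric] v_def by (auto intro!: span_sum span_scale intro: span_base)
    show "norm u \<le> \<kappa> / 4" if "u \<in> v ` A" for u
    proof -
      obtain k where k: "k \<in> A" "u = v k" using \<open>u \<in> v ` A\<close> by blast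
      have "norm u \<le> (\<Sum>e\<in>E. \<delta> * q)"
        unfolding k(2) v_def
      proof (rule sum_norm_le)
        fix e assume e: "e \<in> E"
        have "k e \<le> m" using k e by (auto simp: A_def)
        then have "real (k e) \<le> q" using m(1) by linarith
        moreover have "norm e = 1" by (rule norm_E[OF e])
        ultimately show "norm ((\<delta> * real (k e)) *\<^sub>R e) \<le> \<delta> * q" using \<delta> by simp
      qed
      also have "\<dots> = real (card E) * (\<delta> * q)" by simp
      also have "\<dots> \<le> real DIM('a) * (\<delta> * q)" using E(2) \<delta> q by (intro mult_right_mono) auto
      also have "\<dots> = \<kappa> / 4" using \<delta> by (simp add: q_def)
      finally show ?thesis .
    qed
    show "\<delta> \<le> dist u w" if "u \<in> v ` A" "w \<in> v ` A" "u \<noteq> w" for u w using sep that by auto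
    have "card (v ` A) = Suc m ^ (DIM('a) - d)"
      using card_image[OF inj] finite_E E(2) by (simp add: A_def card_PiE)
    moreover have "q ^ (DIM('a) - d) \<le> real (Suc m) ^ (DIM('a) - d)" using m q by (intro power_mono) auto
    ultimately show "(\<kappa> / (4 * real DIM('a) * \<delta>)) ^ (DIM('a) - d) \<le> real (card (v ` A))"
      by (simp add: q_def)
  qed
qed

text \<open>
  A volume comparison in the ambient space. Around each \<open>p \<in> P\<close> place the balls of radius \<open>\<delta> / 4\<close>
  centred at \<open>p + v\<close> with \<open>v\<close> in a \<open>\<delta>\<close>-grid of normal vectors. The point \<open>p + v\<close> projects to \<open>p\<close> and the
  projection is 2-Lipschitz, so each of these balls projects into \<open>ball p (\<delta> / 2)\<close>. Hence balls
  belonging to different \<open>p\<close> are disjoint, and all of them lie in \<open>ball 0 (R + \<kappa>)\<close>.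
\<close>
lemma card_separated_le:
  fixes \<delta> :: real
  assumes P: "finite P" "P \<subseteq> M" and sep: "\<And>p q. p \<in> P \<Longrightarrow> q \<in> P \<Longrightarrow> p \<noteq> q \<Longrightarrow> \<delta> \<le> dist p q"
    and \<delta>: "0 < \<delta>" "\<delta> \<le> \<kappa>" and R: "M \<subseteq> cball 0 R" and d: "d \<le> DIM('a)"
  shows "real (card P) * \<delta> ^ d \<le> packing_bound DIM('a) d \<kappa> R"
proof (cases "P = {}")
  case True
  obtain x where "x \<in> M" using M_nonempty by blast
  then have "0 \<le> R" using R by (metis dist_0_norm mem_cball norm_ge_zero order_trans subsetD)
  then show ?thesis using True \<kappa>_pos \<delta> by (simp add: packing_bound_def)
next
  case False
  then obtain x where "x \<in> M" using P by blast
  then have R0: "0 \<le> R" using R by (metis dist_0_norm mem_cball norm_ge_zero order_trans subsetD)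
  let ?D = "DIM('a)"
  let ?q = "\<kappa> / (4 * real ?D * \<delta>)"
  define grid where "grid p G \<longleftrightarrow> finite G \<and> G \<subseteq> proximal_normals M p \<and> (\<forall>v\<in>G. norm v \<le> \<kappa> / 4) \<and>
      (\<forall>v\<in>G. \<forall>w\<in>G. v \<noteq> w \<longrightarrow> \<delta> \<le> dist v w) \<and> ?q ^ (?D - d) \<le> real (card G)" for p G
  have "\<exists>G. grid p G" if "p \<in> P" for p
  proof -
    have "p \<in> M" using that P by blast
    then show ?thesis
    proof (rule normal_grid[OF _ \<delta>(1)])
      fix G assume "finite G" "G \<subseteq> proximal_normals M p"
        "\<And>v. v \<in> G \<Longrightarrow> norm v \<le> \<kappa> / 4" "\<And>v w. v \<in> G \<Longrightarrow> w \<in> G \<Longrightarrow> v \<noteq> w \<Longrightarrow> \<delta> \<le> dist v w"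
        "?q ^ (?D - d) \<le> real (card G)"
      then have "grid p G" unfolding grid_def by (intro conjI ballI impI)
      then show ?thesis ..
    qed
  qed
  then obtain G where "\<And>p. p \<in> P \<Longrightarrow> grid p (G p)" by metis
  then have G: "\<And>p. p \<in> P \<Longrightarrow> finite (G p)"
    "\<And>p. p \<in> P \<Longrightarrow> G p \<subseteq> proximal_normals M p" "\<And>p v. p \<in> P \<Longrightarrow> v \<in> G p \<Longrightarrow> norm v \<le> \<kappa> / 4"
    "\<And>p v w. p \<in> P \<Longrightarrow> v \<in> G p \<Longrightarrow> w \<in> G p \<Longrightarrow> v \<noteq> w \<Longrightarrow> \<delta> \<le> dist v w"
    "\<And>p. p \<in> P \<Longrightarrow> ?q ^ (?D - d) \<le> real (card (G p))"
    by (simp_all add: grid_def)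
  define I where "I = Sigma P G"
  have finI: "finite I" using P G by (auto simp: I_def)
  define B where "B i = ball (fst i + snd i) (\<delta> / 4)" for i :: "'a \<times> 'a"
  have foot: "dist (proj z) p < \<delta> / 2" if "p \<in> P" "v \<in> G p" "z \<in> B (p, v)" for p v z
  proof -
    have pM: "p \<in> M" using P that by blast
    have pv: "proj (p + v) = p"
      using G(2,3)[OF that(1)] that(2) pM \<kappa>_pos by (intro proj_add_proximal_normal) force+
    have zd: "dist z (p + v) < \<delta> / 4" using that by (simp add: B_def dist_commute)
    have i1: "infdist (p + v) M \<le> \<kappa> / 4"
      using infdist_le[OF pM, of "p + v"] G(3)[OF that(1,2)] by (simp add: dist_norm)
    have "infdist z M \<le> \<kappa> / 2"
      using infdist_triangle[of z M "p + v"] i1 zd \<delta> by simp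
    moreover have "infdist (p + v) M \<le> \<kappa> / 2" using i1 \<kappa>_pos by simp
    ultimately have "dist (proj z) (proj (p + v)) \<le> 2 * dist z (p + v)" by (rule proj_lipschitz)
    then show ?thesis using pv zd by simp
  qed
  have disj: "disjoint_family_on B I"
    unfolding disjoint_family_on_def
  proof (intro ballI impI)
    fix i j assume ij: "i \<in> I" "j \<in> I" "i \<noteq> j"
    obtain p v q w where pq: "i = (p, v)" "j = (q, w)" "p \<in> P" "q \<in> P" "v \<in> G p" "w \<in> G q"
      using ij by (auto simp: I_def)
    have False if "z \<in> B i" "z \<in> B j" for z
    proof (cases "p = q")
      case True
      then have "\<delta> \<le> dist v w" using G(4) pq ij by auto
      moreover have "dist v w = dist (p + v) (q + w)" using True by (simp add: dist_norm)
      moreover have "dist (p + v) z < \<delta> / 4" "dist (q + w) z < \<delta> / 4" using that pq by (auto simp: B_def)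
      ultimately show False using dist_triangle3[of "p + v" "q + w" z] \<delta> by (simp add: dist_commute)
    next
      case False
      then have "\<delta> \<le> dist p q" using sep pq by blast
      moreover have "dist (proj z) p < \<delta> / 2" "dist (proj z) q < \<delta> / 2"
        using foot that pq by auto
      ultimately show False using dist_triangle3[of p q "proj z"] by simp
    qed
    then show "B i \<inter> B j = {}" by blast
  qed
  let ?w = "unit_ball_vol (real ?D)"
  have "(\<Sum>i\<in>I. measure lborel (B i)) = measure lborel (\<Union>i\<in>I. B i)"
  proof (rule measure_finite_Union[OF finI _ disj, symmetric])
    show "emeasure lborel (B i) \<noteq> \<infinity>" if "i \<in> I" for i
      using emeasure_lborel_ball_finite[of "fst i + snd i" "\<delta> / 4"] by (auto simp: B_def)
  qed (auto simp: B_def)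
  also have "\<dots> \<le> measure lborel (ball 0 (R + \<kappa>) :: 'a set)"
  proof (rule measure_mono_fmeasurable)
    show "(\<Union>i\<in>I. B i) \<subseteq> ball 0 (R + \<kappa>)"
    proof safe
      fix p v z assume i: "(p, v) \<in> I" and z: "z \<in> B (p, v)"
      then have "p \<in> P" "v \<in> G p" by (auto simp: I_def)
      then have "norm p \<le> R" "norm v \<le> \<kappa> / 4" using P R G by auto
      moreover have "norm (z - (p + v)) < \<delta> / 4" using z by (simp add: B_def dist_norm norm_minus_commute)
      moreover have "norm z \<le> norm (z - (p + v)) + (norm p + norm v)"
        using norm_triangle_ineq[of "z - (p + v)" "p + v"] norm_triangle_ineq[of p v] by simp
      ultimately show "z \<in> ball 0 (R + \<kappa>)" using \<delta> by simp
    qed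
    show "(\<Union>i\<in>I. B i) \<in> sets lborel" by (auto simp: B_def finI)
  qed (use emeasure_lborel_ball_finite[of "0::'a" "R + \<kappa>"] in \<open>simp add: fmeasurable_def\<close>)
  also have "\<dots> = ?w * (R + \<kappa>) ^ ?D" using R0 \<kappa>_pos by (simp add: content_ball)
  also have "(\<Sum>i\<in>I. measure lborel (B i)) = real (card I) * (?w * (\<delta> / 4) ^ ?D)"
    using \<delta> by (simp add: B_def content_ball)
  finally have "?w * (real (card I) * (\<delta> / 4) ^ ?D) \<le> ?w * (R + \<kappa>) ^ ?D" by (simp add: mult_ac)
  then have cI: "real (card I) * (\<delta> / 4) ^ ?D \<le> (R + \<kappa>) ^ ?D" by simp
  have "real (card P) * ?q ^ (?D - d) = (\<Sum>p\<in>P. ?q ^ (?D - d))" by simp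
  also have "\<dots> \<le> (\<Sum>p\<in>P. real (card (G p)))" by (intro sum_mono G)
  also have "\<dots> = real (card I)" using P G by (simp add: I_def card_SigmaI)
  finally have "real (card P) * ?q ^ (?D - d) * (\<delta> / 4) ^ ?D \<le> (R + \<kappa>) ^ ?D"
    using cI \<delta> by (meson mult_right_mono order_trans zero_le_divide_iff zero_le_numeral zero_le_power less_imp_le)
  moreover have "?q ^ (?D - d) * (\<delta> / 4) ^ ?D = \<delta> ^ d * ((\<kappa> / (4 * real ?D)) ^ (?D - d) * (1 / 4) ^ ?D)"
  proof -
    have "\<delta> ^ ?D = \<delta> ^ (?D - d) * \<delta> ^ d" using d by (simp flip: power_add)
    then show ?thesis using \<delta> by (simp add: power_divide power_mult_distrib field_simps)
  qed
  ultimately have "real (card P) * \<delta> ^ d * ((\<kappa> / (4 * real ?D)) ^ (?D - d) * (1 / 4) ^ ?D) \<le> (R + \<kappa>) ^ ?D"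
    by (simp add: mult.assoc)
  moreover have "((\<kappa> / (4 * real ?D)) ^ (?D - d) * (1 / 4) ^ ?D) = 1 / (4 ^ ?D * (4 * real ?D / \<kappa>) ^ (?D - d))"
    using \<kappa>_pos by (simp add: power_divide power_mult_distrib)
  ultimately have "real (card P) * \<delta> ^ d * (1 / (4 ^ ?D * (4 * real ?D / \<kappa>) ^ (?D - d))) \<le> (R + \<kappa>) ^ ?D"
    by simp
  moreover have "0 < 4 ^ ?D * (4 * real ?D / \<kappa>) ^ (?D - d)" using \<kappa>_pos by simp
  ultimately have "real (card P) * \<delta> ^ d \<le> (R + \<kappa>) ^ ?D * (4 ^ ?D * (4 * real ?D / \<kappa>) ^ (?D - d))"
    by (simp add: pos_divide_le_eq)
  then show ?thesis by (simp only: packing_bound_def power_mult_distrib mult_ac)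
qed

text \<open>
  A separated subset of maximal cardinality is a net.
\<close>
lemma finite_net:
  fixes \<delta> :: real
  assumes \<delta>: "0 < \<delta>" "\<delta> \<le> \<kappa>" and R: "M \<subseteq> cball 0 R" and d: "d \<le> DIM('a)"
  obtains P where "finite P" "P \<subseteq> M" "real (card P) * \<delta> ^ d \<le> packing_bound DIM('a) d \<kappa> R"
    "\<And>x. x \<in> M \<Longrightarrow> \<exists>p\<in>P. dist x p < \<delta>"
proof -
  define sep where "sep P \<longleftrightarrow> finite P \<and> P \<subseteq> M \<and> (\<forall>p\<in>P. \<forall>q\<in>P. p \<noteq> q \<longrightarrow> \<delta> \<le> dist p q)" for P
  have bound: "real (card P) * \<delta> ^ d \<le> packing_bound DIM('a) d \<kappa> R" if "sep P" for P
  proof (rule card_separated_le[OF _ _ _ \<delta> R d])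
    show "finite P" "P \<subseteq> M" using that by (simp_all add: sep_def)
    show "\<delta> \<le> dist p q" if "p \<in> P" "q \<in> P" "p \<noteq> q" for p q
      using that \<open>sep P\<close> by (simp add: sep_def)
  qed
  have "card P \<le> nat \<lfloor>packing_bound DIM('a) d \<kappa> R / \<delta> ^ d\<rfloor>" if "sep P" for P
  proof -
    have "real (card P) \<le> packing_bound DIM('a) d \<kappa> R / \<delta> ^ d" using bound[OF that] \<delta> by (simp add: pos_le_divide_eq)
    then show ?thesis by linarith
  qed
  then have card_le: "\<forall>P. sep P \<longrightarrow> card P < Suc (nat \<lfloor>packing_bound DIM('a) d \<kappa> R / \<delta> ^ d\<rfloor>)"
    by (simp add: less_Suc_eq_le)
  have "sep {}" by (simp add: sep_def)
  from ex_has_greatest_nat[OF this card_le]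
  obtain P where P: "sep P" "\<And>P'. sep P' \<Longrightarrow> card P' \<le> card P" by auto
  have "\<exists>p\<in>P. dist x p < \<delta>" if x: "x \<in> M" for x
  proof (rule ccontr)
    assume *: "\<not> (\<exists>p\<in>P. dist x p < \<delta>)"
    then have "x \<notin> P" using \<delta> by auto
    have "sep (insert x P)" using * P(1) x by (auto simp: sep_def dist_commute not_less)
    from P(2)[OF this] show False using \<open>x \<notin> P\<close> P(1) by (simp add: sep_def)
  qed
  then show ?thesis using that[of P] P(1) bound[OF P(1)] by (auto simp: sep_def)
qed

end

section \<open>The tangential projection covers a disc\<close>

context reach_manifold
begin

lemma orthonormal_tangent_basis:
  assumes "x \<in> M"
  obtains E where "orthonormal E" "card E = d" "proximal_normals M x = {v. \<forall>e\<in>E. v \<bullet> e = 0}"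
proof -
  obtain T where T: "subspace T" "dim T = d" "proximal_normals M x = T\<^sup>\<bottom>"
    using normal_space[OF assms] by blast
  obtain E where E: "orthonormal E" "card E = dim T" "span E = T"
    by (rule orthonormal_basis_exists[OF T(1)])
  have "T\<^sup>\<bottom> = {v. \<forall>e\<in>E. v \<bullet> e = 0}"
  proof safe
    show "v \<bullet> e = 0" if "v \<in> T\<^sup>\<bottom>" "e \<in> E" for v e
      using that E(3) span_base by (auto simp: orthogonal_comp_def orthogonal_def inner_commute)
    show "v \<in> T\<^sup>\<bottom>" if "\<forall>e\<in>E. v \<bullet> e = 0" for v
      using that orthogonal_to_span[of _ E v] E(3)
      by (auto simp: orthogonal_comp_def orthogonal_def inner_commute)
  qed
  then show ?thesis using that[of E] E T by simp
qed

text \<open>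
  Let \<open>W\<close> be the projection of \<open>M \<inter> cball x (\<kappa> / 2)\<close> to the tangent space at \<open>x\<close>, and suppose that
  a small tangent vector \<open>v\<close> is missing from the compact set \<open>W\<close>. The ball around \<open>v\<close> that touches
  \<open>W\<close> lifts to a ball, with the same tangential direction \<open>e\<close>, that touches \<open>M\<close> from
  outside at some \<open>y\<close> near \<open>x\<close>; so \<open>e\<close> is a unit vector that is tangent at \<open>x\<close> and a proximal normal at
  \<open>y\<close> (step \<open>touch\<close>). Let \<open>\<rho>\<close> be the infimum of the norms of missing vectors and choose \<open>v\<close> of
  norm close to \<open>\<rho>\<close>.
  
  If \<open>\<rho> > 0\<close>, both vectors \<open>(\<rho> / 2) e\<close> and \<open>- (\<rho> / 2) e\<close> are in \<open>W\<close>, and one of them is the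
  projection of a point \<open>z \<in> M\<close> with \<open>|(z - y) \<bullet> e| \<ge> \<rho> / 2\<close> and \<open>|z - y| \<le> 6 \<rho>\<close>. As \<open>e\<close> is normal at
  \<open>y\<close>, this forces \<open>\<kappa> \<le> 36 \<rho>\<close>. If \<open>\<rho> = 0\<close>, there are such \<open>y\<close> tending to \<open>x\<close>, and a limit of the
  directions \<open>e\<close> is a unit vector both tangent and normal at \<open>x\<close>.
\<close>
lemma tangent_projection_covers_disc:
  assumes x: "x \<in> M" and E: "orthonormal E" and N: "proximal_normals M x = {v. \<forall>e\<in>E. v \<bullet> e = 0}"
    and w: "w \<in> span E" "norm w < \<kappa> / 100"
  shows "\<exists>y\<in>M. norm (y - x) \<le> 4 / 3 * norm w \<and> coord_proj E (y - x) = w"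
proof -
  interpret orthonormal E by fact
  define A where "A = M \<inter> cball x (\<kappa> / 2)"
  define pr where "pr y = coord_proj E (y - x)" for y
  define W where "W = pr ` A"
  have "compact W"
    unfolding W_def pr_def A_def using compact_M
    by (intro compact_continuous_image continuous_coord_proj compact_Int_closed) auto
  have "x \<in> A" using x \<kappa>_pos by (simp add: A_def)
  moreover have "pr x = 0" by (simp add: pr_def coord_proj_def)
  ultimately have "0 \<in> W" unfolding W_def by (metis imageI)
  have near: "norm (y - x) \<le> 4 / 3 * norm (pr y)" if y: "y \<in> A" for y
  proof -
    define n where "n = (y - x) - pr y"
    have n: "n \<in> proximal_normals M x"
      unfolding N using inner_coord_proj[OF span_base] by (simp add: n_def pr_def inner_diff_left)
    have "pr y \<bullet> n = 0"
      using inner_coord_proj[OF coord_proj_in_span, of "y - x" "y - x"]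
      by (simp add: n_def pr_def inner_diff_right inner_commute)
    then have "(y - x) \<bullet> n = (norm n)\<^sup>2"
      by (simp add: n_def inner_diff_left flip: dot_square_norm)
    then have "2 * \<kappa> * (norm n)\<^sup>2 \<le> norm n * (norm (y - x))\<^sup>2"
      using proximal_normal_reach[OF x n, of y] y by (simp add: A_def)
    also have "\<dots> \<le> norm n * (\<kappa> / 2 * norm (y - x))"
      unfolding power2_eq_square
      using y by (intro mult_left_mono mult_right_mono) (auto simp: A_def dist_norm norm_minus_commute)
    finally have "norm n * norm n \<le> norm n * (norm (y - x) / 4)"
      using \<kappa>_pos by (simp add: power2_eq_square field_simps)
    then have "norm n \<le> norm (y - x) / 4" by (cases "n = 0") auto
    moreover have "norm (y - x) \<le> norm (pr y) + norm n"
      using norm_triangle_ineq[of "pr y" n] by (simp add: n_def)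
    ultimately show ?thesis by simp
  qed
  have touch: "\<exists>y e. y \<in> M \<and> norm (y - x) \<le> 8 / 3 * norm v \<and> e \<in> span E \<and> norm e = 1 \<and>
      e \<in> proximal_normals M y" if v: "v \<in> span E" "v \<notin> W" "norm v < \<kappa> / 100" for v
  proof -
    obtain v' where v': "v' \<in> W" "infdist v W = dist v v'"
      using infdist_attains_inf[OF compact_imp_closed[OF \<open>compact W\<close>], of v] \<open>0 \<in> W\<close> by blast
    obtain y where y: "y \<in> A" "pr y = v'" using v' by (auto simp: W_def)
    define s where "s = norm (v - v')"
    have s: "0 < s" using v v' by (auto simp: s_def)
    define e where "e = (v - v') /\<^sub>R s"
    have "v' \<in> span E" using y(2) coord_proj_in_span by (auto simp: pr_def)
    then have e: "e \<in> span E" "norm e = 1" using v s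
      by (auto simp: e_def s_def intro!: span_scale span_diff)
    have "s \<le> norm v" using infdist_le[OF \<open>0 \<in> W\<close>, of v] v'(2) by (simp add: s_def dist_norm)
    moreover have "norm v' \<le> norm v + s" unfolding s_def by (metis norm_minus_commute norm_triangle_sub)
    ultimately have ny: "norm (y - x) \<le> 8 / 3 * norm v" using near[OF y(1)] y(2) by simp
    \<comment> \<open>The first constant serves the points of \<open>M\<close> in \<open>cball x (\<kappa> / 2)\<close>, the second one the others, which
      are at distance at least \<open>\<kappa> / 4\<close> from \<open>y\<close>.\<close>
    define c where "c = max (1 / (2 * s)) (4 / \<kappa>)"
    have "(z - y) \<bullet> e \<le> c * (norm (z - y))\<^sup>2" if z: "z \<in> M" for z
    proof (cases "z \<in> A")
      case True
      then have "s \<le> norm (pr z - v)"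
        using infdist_le[of "pr z" W v] v'(2) by (simp add: W_def s_def dist_norm norm_minus_commute)
      then have "norm (v - v') \<le> dist (v' + (v - v')) (pr z)" by (simp add: s_def dist_norm norm_minus_commute)
      then have "2 * ((pr z - v') \<bullet> (v - v')) \<le> (norm (pr z - v'))\<^sup>2"
        using nearest_iff_inner_le by blast
      moreover have "(pr z - v') \<bullet> (v - v') = s * ((z - y) \<bullet> e)"
      proof -
        have "pr z - v' = coord_proj E (z - y)"
          using coord_proj_diff[of "z - x" "y - x"] y(2) by (simp add: pr_def)
        moreover have "v - v' = s *\<^sub>R e" using s by (simp add: e_def)
        ultimately show ?thesis using inner_coord_proj[OF e(1), of "z - y"] by simp
      qed
      moreover have "(norm (pr z - v'))\<^sup>2 \<le> (norm (z - y))\<^sup>2"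
        using coord_proj_diff[of "z - x" "y - x"] y(2) norm_coord_proj_le[of "z - y"]
        by (intro power_mono) (simp_all add: pr_def)
      ultimately have "2 * (s * ((z - y) \<bullet> e)) \<le> (norm (z - y))\<^sup>2" by linarith
      then have "(z - y) \<bullet> e \<le> 1 / (2 * s) * (norm (z - y))\<^sup>2" using s by (simp add: field_simps)
      also have "\<dots> \<le> c * (norm (z - y))\<^sup>2" by (intro mult_right_mono) (auto simp: c_def)
      finally show ?thesis .
    next
      case False
      then have "\<kappa> / 2 < norm (z - x)" using z by (simp add: A_def dist_norm norm_minus_commute)
      moreover have "norm (z - x) \<le> norm (z - y) + norm (y - x)" using norm_triangle_ineq[of "z - y" "y - x"] by simp
      ultimately have far: "\<kappa> / 4 \<le> norm (z - y)" using ny v(3) \<kappa>_pos by simp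
      have "(z - y) \<bullet> e \<le> norm (z - y)" using norm_cauchy_schwarz[of "z - y" e] e by simp
      also have "\<dots> \<le> norm (z - y) * (4 / \<kappa> * norm (z - y))"
        using far \<kappa>_pos by (intro mult_le_cancel_left1[THEN iffD2]) (auto simp: field_simps)
      also have "\<dots> = 4 / \<kappa> * (norm (z - y))\<^sup>2" by (simp add: power2_eq_square)
      also have "\<dots> \<le> c * (norm (z - y))\<^sup>2" by (intro mult_right_mono) (auto simp: c_def)
      finally show ?thesis .
    qed
    then have "e \<in> proximal_normals M y" unfolding proximal_normals_def by blast
    then show ?thesis using y e ny by (auto simp: A_def)
  qed
  have "w \<in> W"
  proof (rule ccontr)
    assume "w \<notin> W"
    define Bad where "Bad = {v \<in> span E. v \<notin> W}"
    have "w \<in> Bad" using w \<open>w \<notin> W\<close> by (simp add: Bad_def)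
    define \<rho> where "\<rho> = (INF v\<in>Bad. norm v)"
    have bdd: "bdd_below (norm ` Bad)" by (intro bdd_belowI[of _ 0]) auto
    have \<rho>_le: "\<rho> \<le> norm v" if "v \<in> Bad" for v
      unfolding \<rho>_def using that bdd by (intro cINF_lower)
    have \<rho>0: "0 \<le> \<rho>" unfolding \<rho>_def using \<open>w \<in> Bad\<close> by (intro cINF_greatest) auto
    have \<rho>\<kappa>: "\<rho> < \<kappa> / 100" using \<rho>_le[OF \<open>w \<in> Bad\<close>] w by simp
    have approx: "\<exists>v\<in>Bad. norm v < t" if "\<rho> < t" for t
      using that \<open>w \<in> Bad\<close> bdd unfolding \<rho>_def by (subst (asm) cINF_less_iff) auto
    show False
    proof (cases "\<rho> = 0")
      case False
      with \<rho>0 have "0 < \<rho>" by simp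
      obtain v where v: "v \<in> Bad" "norm v < min (2 * \<rho>) (\<kappa> / 100)"
        using approx[of "min (2 * \<rho>) (\<kappa> / 100)"] \<open>0 < \<rho>\<close> \<rho>\<kappa> by auto
      obtain y e where y: "y \<in> M" "norm (y - x) \<le> 8 / 3 * norm v" and e: "e \<in> span E" "norm e = 1"
          "e \<in> proximal_normals M y"
        using touch[of v] v by (auto simp: Bad_def)
      \<comment> \<open>The sign makes \<open>(z - x) \<bullet> e\<close> and \<open>- ((y - x) \<bullet> e)\<close> add up without cancellation.\<close>
      define \<sigma> :: real where "\<sigma> = (if (y - x) \<bullet> e \<le> 0 then 1 else -1)"
      define w' where "w' = (\<sigma> * (\<rho> / 2)) *\<^sub>R e"
      have w': "w' \<in> span E" "norm w' = \<rho> / 2"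
        using e \<open>0 < \<rho>\<close> by (auto simp: w'_def \<sigma>_def span_scale)
      then have "w' \<in> W" using \<rho>_le[of w'] \<open>0 < \<rho>\<close> by (auto simp: Bad_def)
      then obtain z where z: "z \<in> A" "pr z = w'" by (auto simp: W_def)
      have "(z - x) \<bullet> e = \<sigma> * (\<rho> / 2)"
        using inner_coord_proj[OF e(1), of "z - x"] z e by (simp add: pr_def w'_def dot_square_norm)
      then have "\<rho> / 2 \<le> \<bar>(z - x) \<bullet> e - (y - x) \<bullet> e\<bar>"
      proof (cases "(y - x) \<bullet> e \<le> 0")
        case True
        with \<open>(z - x) \<bullet> e = _\<close> have "(z - x) \<bullet> e = \<rho> / 2" by (simp add: \<sigma>_def)
        with True show ?thesis by linarith
      next
        case False
        with \<open>(z - x) \<bullet> e = _\<close> have "(z - x) \<bullet> e = - (\<rho> / 2)" by (simp add: \<sigma>_def)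
        with False show ?thesis by linarith
      qed
      then have "\<rho> / 2 \<le> \<bar>(z - y) \<bullet> e\<bar>" by (simp add: inner_diff_left)
      then have "2 * \<kappa> * (\<rho> / 2) \<le> 2 * \<kappa> * \<bar>(z - y) \<bullet> e\<bar>" using \<kappa>_pos by (intro mult_left_mono) auto
      also have "\<dots> \<le> (norm (z - y))\<^sup>2"
        using proximal_normal_abs_le[OF y(1) e(3), of z] z e by (simp add: A_def)
      also have "\<dots> \<le> (6 * \<rho>)\<^sup>2"
      proof (intro power_mono)
        show "norm (z - y) \<le> 6 * \<rho>"
          using norm_triangle_ineq4[of "z - x" "y - x"] near[OF z(1)] z(2) w'(2) y(2) v(2) by simp
      qed simp
      finally have "\<rho> * \<kappa> \<le> \<rho> * (36 * \<rho>)" by (simp add: power2_eq_square mult_ac)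
      then have "\<kappa> \<le> 36 * \<rho>" using \<open>0 < \<rho>\<close> by simp
      then show False using \<rho>\<kappa> \<rho>0 by simp
    next
      case True
      have "\<exists>y e. y \<in> M \<and> norm (y - x) \<le> 8 / 3 * inverse (real (Suc k)) \<and> e \<in> span E \<and> norm e = 1 \<and>
        e \<in> proximal_normals M y" for k
      proof -
        obtain v where v: "v \<in> Bad" "norm v < min (inverse (real (Suc k))) (\<kappa> / 100)"
          using approx[of "min (inverse (real (Suc k))) (\<kappa> / 100)"] True \<kappa>_pos by auto
        obtain y e where y: "y \<in> M" "norm (y - x) \<le> 8 / 3 * norm v" and e: "e \<in> span E" "norm e = 1"
            "e \<in> proximal_normals M y"
          using touch[of v] v by (auto simp: Bad_def)
        have "norm (y - x) \<le> 8 / 3 * inverse (real (Suc k))" using y(2) v by simp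
        with y(1) e show ?thesis by blast
      qed
      then obtain y e where y: "\<And>k. y k \<in> M" "\<And>k. norm (y k - x) \<le> 8 / 3 * inverse (real (Suc k))"
        and e: "\<And>k. e k \<in> span E" "\<And>k. norm (e k) = 1" "\<And>k. e k \<in> proximal_normals M (y k)"
        by metis
      have "(\<lambda>k. y k - x) \<longlonglongrightarrow> 0"
      proof (rule Lim_null_comparison)
        show "\<forall>\<^sub>F k in sequentially. norm (y k - x) \<le> 8 / 3 * inverse (real (Suc k))"
          by (intro always_eventually allI y(2))
        show "(\<lambda>k. 8 / 3 * inverse (real (Suc k))) \<longlonglongrightarrow> 0"
          using tendsto_mult_right_zero[OF LIMSEQ_inverse_real_of_nat, of "8 / 3"] by simp
      qed
      then have y_lim: "y \<longlonglongrightarrow> x" by (simp add: LIM_zero_iff)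
      obtain e0 r where e0: "e0 \<in> sphere 0 1" "strict_mono r" "(e \<circ> r) \<longlonglongrightarrow> e0"
        using compact_sphere[of "0::'a" 1] e(2) unfolding compact_def
        by (metis mem_sphere_0)
      have yr: "(\<lambda>k. y (r k)) \<longlonglongrightarrow> x"
        using LIMSEQ_subseq_LIMSEQ[OF y_lim e0(2)] by (simp add: o_def)
      have er: "(\<lambda>k. e (r k)) \<longlonglongrightarrow> e0" using e0(3) by (simp add: o_def)
      have span0: "e0 \<in> span E"
        using closed_sequentially[OF closed_subspace[OF subspace_span], of "\<lambda>k. e (r k)"] e(1) er by blast
      have "2 * \<kappa> * ((z - x) \<bullet> e0) \<le> (norm (z - x))\<^sup>2" if z: "z \<in> M" for z
      proof (rule LIMSEQ_le)
        show "(\<lambda>k. 2 * \<kappa> * ((z - y (r k)) \<bullet> e (r k))) \<longlonglongrightarrow> 2 * \<kappa> * ((z - x) \<bullet> e0)"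
          by (intro tendsto_intros yr er)
        show "(\<lambda>k. (norm (z - y (r k)))\<^sup>2) \<longlonglongrightarrow> (norm (z - x))\<^sup>2"
          by (intro tendsto_intros yr)
        show "\<exists>N. \<forall>k\<ge>N. 2 * \<kappa> * ((z - y (r k)) \<bullet> e (r k)) \<le> (norm (z - y (r k)))\<^sup>2"
          using proximal_normal_reach[OF y(1) e(3) z] e(2) by (intro exI[of _ 0]) simp
      qed
      then have "(z - x) \<bullet> e0 \<le> 1 / (2 * \<kappa>) * (norm (z - x))\<^sup>2" if "z \<in> M" for z
        using that \<kappa>_pos by (simp add: field_simps)
      then have "e0 \<in> proximal_normals M x" unfolding proximal_normals_def by blast
      then have "coord_proj E e0 = 0" by (simp add: N coord_proj_def)
      then have "e0 = 0" using coord_proj_ident[OF span0] by simp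
      then show False using e0(1) by simp
    qed
  qed
  then obtain y where "y \<in> A" "pr y = w" by (auto simp: W_def)
  then show ?thesis using near[of y] by (auto simp: A_def pr_def)
qed

end

section \<open>Hausdorff measure of balls and of the whole manifold\<close>

lemma emeasure_lborel_coordinate_box:
  fixes lo hi :: "'a::euclidean_space \<Rightarrow> real"
  assumes "\<And>b. b \<in> Basis \<Longrightarrow> lo b \<le> hi b"
  shows "emeasure lborel (cbox (\<Sum>b\<in>Basis. lo b *\<^sub>R b) (\<Sum>b\<in>Basis. hi b *\<^sub>R b)) =
    ennreal (\<Prod>b\<in>Basis. hi b - lo b)"
  using assms by (simp add: emeasure_lborel_cbox_eq inner_diff_left)

text \<open>
  The orthonormal coordinates \<open>(y - x) \<bullet> e\<close> are identified with \<open>d\<close> of the standard coordinates and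
  the remaining standard coordinates range over \<open>[0, 1]\<close>. A covering set of diameter \<open>\<Delta>\<close> then gives a
  box of Lebesgue measure \<open>(2 \<Delta>)\<^sup>d\<close>, and these boxes cover a box of measure \<open>(2 s)\<^sup>d\<close>.
\<close>
lemma hausdorff_outer_ge_projected_box:
  fixes A E :: "'a::euclidean_space set" and x :: 'a
  assumes E: "orthonormal E" "card E = d" and d: "0 < d" and s: "0 \<le> s"
    and cover: "\<And>c. (\<And>e. e \<in> E \<Longrightarrow> \<bar>c e\<bar> \<le> s) \<Longrightarrow> \<exists>y\<in>A. \<forall>e\<in>E. (y - x) \<bullet> e = c e"
  shows "ennreal (s ^ d) \<le> hausdorff_outer d A"
proof -
  interpret orthonormal E by fact
  have "card E \<le> DIM('a)"
  proof (rule independent_bound[THEN conjunct2])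
    show "independent E"
    proof (rule pairwise_orthogonal_independent)
      show "pairwise orthogonal E" using inner_E by (auto simp: pairwise_def orthogonal_def)
      show "0 \<notin> E" using norm_E by force
    qed
  qed
  then obtain B where B: "B \<subseteq> (Basis :: 'a set)" "card B = d"
    using E(2) obtain_subset_with_card_n by metis
  then have finB: "finite B" using finite_Basis finite_subset by blast
  obtain \<beta> where \<beta>: "bij_betw \<beta> E B"
    using finite_same_card_bij[OF finite_E finB] E(2) B(2) by auto
  define \<gamma> where "\<gamma> = inv_into E \<beta>"
  have \<gamma>: "\<gamma> b \<in> E" "\<beta> (\<gamma> b) = b" if "b \<in> B" for b
    using that \<beta> by (auto simp: \<gamma>_def bij_betw_def f_inv_into_f inv_into_into)
  have \<gamma>\<beta>: "\<gamma> (\<beta> e) = e" "\<beta> e \<in> B" if "e \<in> E" for e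
    using that \<beta> by (auto simp: \<gamma>_def bij_betw_def)
  define box where "box lo hi = cbox (\<Sum>b\<in>Basis. (if b \<in> B then lo b else 0) *\<^sub>R b)
      (\<Sum>b\<in>Basis. (if b \<in> B then hi b else (1::real)) *\<^sub>R b)" for lo hi :: "'a \<Rightarrow> real"
  have vol_box: "emeasure lborel (box lo hi) = ennreal (t ^ d)"
    if "0 \<le> t" "\<And>b. b \<in> B \<Longrightarrow> hi b - lo b = t" for lo hi t
  proof -
    have "emeasure lborel (box lo hi) =
        ennreal (\<Prod>b\<in>Basis. (if b \<in> B then hi b else 1) - (if b \<in> B then lo b else 0))"
      unfolding box_def
    proof (rule emeasure_lborel_coordinate_box)
      fix b :: 'a
      show "(if b \<in> B then lo b else 0) \<le> (if b \<in> B then hi b else 1)"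
        using that(1) that(2)[of b] by (cases "b \<in> B") auto
    qed
    also have "(\<Prod>b\<in>Basis. (if b \<in> B then hi b else 1) - (if b \<in> B then lo b else 0)) =
        (\<Prod>b\<in>Basis. if b \<in> B then t else 1)"
      using that(2) by (intro prod.cong) auto
    also have "\<dots> = t ^ d"
      using B by (simp add: prod.If_cases Int_absorb1)
    finally show ?thesis .
  qed
  have mem_box_iff: "z \<in> box lo hi \<longleftrightarrow> (\<forall>b\<in>Basis. if b \<in> B then lo b \<le> z \<bullet> b \<and> z \<bullet> b \<le> hi b else 0 \<le> z \<bullet> b \<and> z \<bullet> b \<le> 1)"
    for z lo hi by (auto simp: box_def mem_box)
  have "ennreal (s ^ d) \<le> (\<Sum>i. ennreal (diameter (C i) ^ d))"
    if C: "A \<subseteq> (\<Union>i. C i)" "\<And>i. bounded (C i)" for C :: "nat \<Rightarrow> 'a set"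
  proof -
    \<comment> \<open>For an empty covering set the centre is arbitrary, but then the box has measure \<open>0\<close>.\<close>
    define p where "p i = (SOME p. p \<in> C i)" for i
    define \<Delta> where "\<Delta> i = diameter (C i)" for i
    have \<Delta>0: "0 \<le> \<Delta> i" for i using C(2) by (simp add: \<Delta>_def diameter_ge_0)
    define Q where "Q i = box (\<lambda>b. (p i - x) \<bullet> \<gamma> b - \<Delta> i) (\<lambda>b. (p i - x) \<bullet> \<gamma> b + \<Delta> i)" for i
    define Q0 where "Q0 = box (\<lambda>_. - s) (\<lambda>_. s)"
    have "Q0 \<subseteq> (\<Union>i. Q i)"
    proof
      fix z assume z: "z \<in> Q0"
      have "\<bar>z \<bullet> \<beta> e\<bar> \<le> s" if "e \<in> E" for e
      proof -
        have "\<beta> e \<in> Basis" "\<beta> e \<in> B" using \<gamma>\<beta>(2)[OF that] B(1) by auto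
        with z have "- s \<le> z \<bullet> \<beta> e \<and> z \<bullet> \<beta> e \<le> s" by (auto simp: Q0_def mem_box_iff)
        then show ?thesis by (simp add: abs_le_iff)
      qed
      then obtain y where y: "y \<in> A" "\<And>e. e \<in> E \<Longrightarrow> (y - x) \<bullet> e = z \<bullet> \<beta> e"
        using cover[of "\<lambda>e. z \<bullet> \<beta> e"] by blast
      obtain i where i: "y \<in> C i" using C(1) y(1) by blast
      have "p i \<in> C i" unfolding p_def using i by (rule someI)
      then have yp: "norm (y - p i) \<le> \<Delta> i"
        using diameter_bounded_bound[OF C(2) i] by (simp add: \<Delta>_def dist_norm)
      have "\<bar>z \<bullet> b - (p i - x) \<bullet> \<gamma> b\<bar> \<le> \<Delta> i" if b: "b \<in> B" for b
      proof -
        have "z \<bullet> b - (p i - x) \<bullet> \<gamma> b = (y - p i) \<bullet> \<gamma> b"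
          using y(2)[OF \<gamma>(1)[OF b]] \<gamma>(2)[OF b] by (simp add: inner_diff_left)
        also have "\<bar>\<dots>\<bar> \<le> norm (y - p i)"
          using Cauchy_Schwarz_ineq2[of "y - p i" "\<gamma> b"] norm_E[OF \<gamma>(1)[OF b]] by simp
        finally show ?thesis using yp by simp
      qed
      moreover have "0 \<le> z \<bullet> b \<and> z \<bullet> b \<le> 1" if "b \<in> Basis" "b \<notin> B" for b
        using z that by (auto simp: Q0_def mem_box_iff)
      ultimately have "z \<in> Q i"
        unfolding Q_def mem_box_iff by (auto simp: abs_le_iff algebra_simps)
      then show "z \<in> (\<Union>i. Q i)" by blast
    qed
    have "ennreal ((2 * s) ^ d) = emeasure lborel Q0"
      unfolding Q0_def using s by (intro vol_box[symmetric]) auto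
    also have "\<dots> \<le> emeasure lborel (\<Union>i. Q i)"
      using \<open>Q0 \<subseteq> _\<close> by (intro emeasure_mono) (auto simp: Q_def box_def)
    also have "\<dots> \<le> (\<Sum>i. emeasure lborel (Q i))"
      by (intro emeasure_subadditive_countably) (auto simp: Q_def box_def)
    also have "\<dots> = (\<Sum>i. ennreal ((2 * \<Delta> i) ^ d))"
      unfolding Q_def using \<Delta>0 by (intro suminf_cong vol_box) auto
    also have "\<dots> = (\<Sum>i. ennreal (2 ^ d) * ennreal (\<Delta> i ^ d))"
      using \<Delta>0 by (simp add: power_mult_distrib ennreal_mult)
    also have "\<dots> = ennreal (2 ^ d) * (\<Sum>i. ennreal (\<Delta> i ^ d))" by simp
    also have "ennreal ((2 * s) ^ d) = ennreal (2 ^ d) * ennreal (s ^ d)"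
      using s by (simp add: power_mult_distrib ennreal_mult)
    finally show ?thesis by (simp add: \<Delta>_def ennreal_mult_le_mult_iff)
  qed
  note covering_sum = this
  show ?thesis
    unfolding hausdorff_outer_def
  proof (rule SUP_upper2[of 1])
    show "ennreal (s ^ d) \<le> (INF C\<in>{C :: nat \<Rightarrow> 'a set. A \<subseteq> \<Union> (range C) \<and> (\<forall>i. bounded (C i) \<and> diameter (C i) \<le> 1)}.
        \<Sum>i. ennreal (diameter (C i) ^ d))"
    proof (rule INF_greatest)
      fix C assume "C \<in> {C :: nat \<Rightarrow> 'a set. A \<subseteq> \<Union> (range C) \<and> (\<forall>i. bounded (C i) \<and> diameter (C i) \<le> 1)}"
      then have C: "A \<subseteq> \<Union> (range C)" "\<And>i. bounded (C i)" by simp_all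
      show "ennreal (s ^ d) \<le> (\<Sum>i. ennreal (diameter (C i) ^ d))"
        by (rule covering_sum[OF C])
    qed
  qed simp
qed

context reach_manifold
begin

text \<open>
  A tangent vector with coordinates at most \<open>r / (2 d)\<close> has norm at most \<open>r / 2\<close>, hence is the projection
  of a point of \<open>M\<close> at distance at most \<open>2 r / 3\<close> from \<open>x\<close>.
\<close>
lemma hausdorff_outer_ball_ge:
  assumes x: "x \<in> M" and d: "0 < d" and r: "0 < r" "r \<le> \<kappa> / 100"
  shows "ennreal ((r / (2 * d)) ^ d) \<le> hausdorff_outer d (M \<inter> ball x r)"
proof -
  obtain E where E: "orthonormal E" "card E = d" "proximal_normals M x = {v. \<forall>e\<in>E. v \<bullet> e = 0}"
    by (rule orthonormal_tangent_basis[OF x])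
  interpret orthonormal E by fact
  show ?thesis
  proof (rule hausdorff_outer_ge_projected_box[OF E(1,2) d, of _ _ x])
    show "0 \<le> r / real (2 * d)" using r by simp
    fix c :: "'a \<Rightarrow> real" assume c: "\<And>e. e \<in> E \<Longrightarrow> \<bar>c e\<bar> \<le> r / real (2 * d)"
    define w where "w = (\<Sum>e\<in>E. c e *\<^sub>R e)"
    have w: "w \<in> span E" unfolding w_def by (intro span_sum span_scale span_base)
    have "norm w \<le> (\<Sum>e\<in>E. r / real (2 * d))"
      unfolding w_def using c norm_E by (intro sum_norm_le) auto
    also have "\<dots> = r / 2" using E(2) d by simp
    finally have nw: "norm w \<le> r / 2" .
    then obtain y where y: "y \<in> M" "norm (y - x) \<le> 4 / 3 * norm w" "coord_proj E (y - x) = w"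
      using tangent_projection_covers_disc[OF x E(1,3) w] r by auto
    have "(y - x) \<bullet> e = c e" if "e \<in> E" for e
      using inner_coord_proj[OF span_base[OF that], of "y - x"] inner_sum_E[OF that] y(3) by (simp add: w_def)
    moreover have "y \<in> ball x r" using y(2) nw r by (simp add: dist_norm norm_minus_commute)
    ultimately show "\<exists>y\<in>M \<inter> ball x r. \<forall>e\<in>E. (y - x) \<bullet> e = c e" using y(1) by blast
  qed
qed

text \<open>
  The balls of radius \<open>r\<close> around an \<open>r\<close>-net have diameter \<open>2 r\<close>, and their number times \<open>r\<^sup>d\<close> is at most the
  packing bound, however small \<open>r\<close> is.
\<close>
lemma hausdorff_outer_le:
  assumes d: "0 < d" "d \<le> DIM('a)" and R: "M \<subseteq> cball 0 R"
  shows "hausdorff_outer d M \<le> ennreal (2 ^ d * packing_bound DIM('a) d \<kappa> R)"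
  unfolding hausdorff_outer_def
proof (rule SUP_least)
  fix \<delta> :: real assume "\<delta> \<in> {0<..}"
  define r where "r = min (\<delta> / 2) \<kappa>"
  have r: "0 < r" "r \<le> \<delta> / 2" "r \<le> \<kappa>" using \<open>\<delta> \<in> _\<close> \<kappa>_pos by (auto simp: r_def)
  obtain P where P: "finite P" "P \<subseteq> M" "real (card P) * r ^ d \<le> packing_bound DIM('a) d \<kappa> R"
    "\<And>x. x \<in> M \<Longrightarrow> \<exists>p\<in>P. dist x p < r"
    using finite_net[OF r(1,3) R d(2)] by metis
  obtain p where p: "bij_betw p {0..<card P} P" using ex_bij_betw_nat_finite[OF P(1)] by blast
  define C where "C i = (if i < card P then cball (p i) r else {})" for i
  show "(INF C\<in>{C :: nat \<Rightarrow> 'a set. M \<subseteq> \<Union> (range C) \<and> (\<forall>i. bounded (C i) \<and> diameter (C i) \<le> \<delta>)}.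
      \<Sum>i. ennreal (diameter (C i) ^ d)) \<le> ennreal (2 ^ d * packing_bound DIM('a) d \<kappa> R)"
  proof (rule INF_lower2[of C])
    have "M \<subseteq> \<Union> (range C)"
    proof
      fix x assume "x \<in> M"
      then obtain q where q: "q \<in> P" "dist x q < r" using P(4) by blast
      then have "q \<in> p ` {0..<card P}" using p by (simp add: bij_betw_def)
      then obtain i where "i < card P" "q = p i" by auto
      then have "x \<in> C i" using q by (simp add: C_def dist_commute)
      then show "x \<in> \<Union> (range C)" by blast
    qed
    moreover have "bounded (C i) \<and> diameter (C i) \<le> \<delta>" for i using r by (simp add: C_def)
    ultimately show "C \<in> {C. M \<subseteq> \<Union> (range C) \<and> (\<forall>i. bounded (C i) \<and> diameter (C i) \<le> \<delta>)}" by blast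
    have "(\<Sum>i. ennreal (diameter (C i) ^ d)) = (\<Sum>i<card P. ennreal (diameter (C i) ^ d))"
      using d by (intro suminf_finite) (auto simp: C_def)
    also have "\<dots> = (\<Sum>i<card P. ennreal ((2 * r) ^ d))"
      using r by (intro sum.cong) (auto simp: C_def)
    also have "\<dots> = ennreal (2 ^ d * (real (card P) * r ^ d))"
      using r by (simp add: power_mult_distrib ennreal_of_nat_eq_real_of_nat ennreal_mult[symmetric] mult_ac)
    also have "\<dots> \<le> ennreal (2 ^ d * packing_bound DIM('a) d \<kappa> R)"
      using P(3) by (intro ennreal_leI mult_left_mono) auto
    finally show "(\<Sum>i. ennreal (diameter (C i) ^ d)) \<le> ennreal (2 ^ d * packing_bound DIM('a) d \<kappa> R)" .
  qed
qed

end

section \<open>Distributions in the noiseless model\<close>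

lemma infdist_less_iff_enlargement:
  assumes "M \<noteq> {}"
  shows "infdist x M < r \<longleftrightarrow> x \<in> enlargement M r"
proof -
  have bdd: "bdd_below (dist x ` M)" by (intro bdd_belowI[of _ 0]) auto
  have "infdist x M < r \<longleftrightarrow> (\<exists>a\<in>M. dist x a < r)"
    using assms bdd by (simp add: infdist_notempty cINF_less_iff)
  also have "\<dots> \<longleftrightarrow> x \<in> enlargement M r" by (simp add: enlargement_def dist_commute)
  finally show ?thesis .
qed

text \<open>
  The supremum defining the reach may fail to be attained, so a point at distance less than \<open>\<kappa>\<close> from \<open>M\<close> is
  handled by an admissible radius beyond this distance. Points of the closure are at distance \<open>0\<close> and
  have a nearest point in \<open>M\<close>, so \<open>M\<close> is closed.
\<close>
lemma noiseless_manifold_reach_manifold: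
  fixes M K :: "'a::euclidean_space set"
  assumes M: "M \<in> noiseless_manifolds d \<kappa> K" and K: "compact K" and \<kappa>: "0 < \<kappa>"
  shows "reach_manifold M \<kappa> d"
proof -
  have sm: "smooth_submanifold d M" and rch: "ennreal \<kappa> \<le> reach M" and MK: "M \<subseteq> K"
    using M by (auto simp: noiseless_manifolds_def manifolds_def)
  have ne: "M \<noteq> {}" using sm by (simp add: smooth_submanifold_def)
  have ex1: "\<exists>!p. p \<in> M \<and> dist x p = infdist x M" if x: "infdist x M < \<kappa>" for x
  proof -
    have "ennreal (infdist x M) < reach M"
      using x rch infdist_nonneg[of x M] by (meson ennreal_lessI less_le_trans \<kappa>)
    then obtain s where s: "s \<in> {ennreal r | r. 0 \<le> r \<and>
        (\<forall>x\<in>enlargement M r. \<exists>!p. p \<in> M \<and> dist x p = infdist x M)}" "ennreal (infdist x M) < s"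
      unfolding reach_def less_Sup_iff by blast
    then obtain r where r: "s = ennreal r" "0 \<le> r"
        "\<forall>x\<in>enlargement M r. \<exists>!p. p \<in> M \<and> dist x p = infdist x M" by blast
    have "infdist x M < r" using s(2) r(1) by (simp add: ennreal_less_iff infdist_nonneg)
    then show ?thesis using r(3) infdist_less_iff_enlargement[OF ne] by blast
  qed
  have "closed M"
  proof -
    have "x \<in> M" if "x \<in> closure M" for x
    proof -
      have "infdist x M = 0" using that in_closure_iff_infdist_zero[OF ne] by blast
      then obtain p where "p \<in> M" "dist x p = 0" using ex1[of x] \<kappa> by auto
      then show ?thesis by simp
    qed
    then show ?thesis using closure_subset_eq by blast
  qed
  then have "compact M" using compact_Int_closed[OF K] MK by (metis inf.absorb_iff2)
  show ?thesis
  proof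
    show "compact M" by fact
    show "M \<noteq> {}" by fact
    show "0 < \<kappa>" by fact
    show "p = q" if "infdist x M < \<kappa>" "p \<in> M" "q \<in> M" "dist x p = infdist x M" "dist x q = infdist x M"
      for x p q using ex1[OF that(1)] that by blast
    show "\<exists>T. subspace T \<and> dim T = d \<and> proximal_normals M x = T\<^sup>\<bottom>" if xM: "x \<in> M" for x
    proof -
      obtain T where "subspace T" "dim T = d" "proximal_normals M x = T\<^sup>\<bottom>"
        by (rule proximal_normals_smooth_submanifold[OF sm xM])
      then show ?thesis by blast
    qed
  qed
qed

lemma sets_hausdorff_measure [measurable_cong]: "sets (hausdorff_measure d) = sets borel"
  using sets.sigma_sets_eq[of "borel :: 'a measure"]
  by (simp add: hausdorff_measure_def sets_measure_of_conv)

text \<open>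
  The construction \<open>measure_of\<close> returns the null measure if the given set function fails to be countably
  additive. One set of nonzero measure therefore certifies that the Hausdorff measure agrees with
  the outer measure on all Borel sets.
\<close>
lemma emeasure_hausdorff_measure_eq_outer:
  fixes A M :: "'a::metric_space set"
  assumes "emeasure (hausdorff_measure d) M \<noteq> 0" "A \<in> sets borel"
  shows "emeasure (hausdorff_measure d) A = hausdorff_outer d A"
proof -
  have sig: "sigma_sets UNIV (sets borel) = (sets borel :: 'a set set)"
    using sets.sigma_sets_eq[of "borel :: 'a measure"] by simp
  have em: "emeasure (hausdorff_measure d :: 'a measure) =
      (\<lambda>B. if B \<in> sets borel \<and> measure_space UNIV (sets borel) (hausdorff_outer d :: 'a set \<Rightarrow> ennreal) then hausdorff_outer d B else 0)"
    unfolding hausdorff_measure_def emeasure_measure_of_conv sig ..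
  have "measure_space UNIV (sets borel) (hausdorff_outer d :: 'a set \<Rightarrow> ennreal)"
    using assms(1) unfolding em by presburger
  then show ?thesis using assms(2) by (simp add: em)
qed

text \<open>
  A probability measure \<open>Q\<close> cannot have a density with respect to the null measure, so the Hausdorff
  measure of \<open>M\<close> is nonzero; this identifies it with the outer measure. The lower bound is
  \<open>g \<ge> b\<close> integrated over \<open>M \<inter> A\<close> against the uniform distribution.
\<close>
lemma dists_on_basic:
  fixes M :: "'a::euclidean_space set"
  assumes Q: "Q \<in> dists_on d b B M" and M: "M \<in> sets borel" and b: "0 < b"
  shows "sets Q = sets borel" "AE y in Q. y \<in> M"
    "\<And>A. A \<in> sets borel \<Longrightarrow>
       ennreal b * (hausdorff_outer d (M \<inter> A) / hausdorff_outer d M) \<le> emeasure Q A"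
    "hausdorff_outer d M \<noteq> 0"
proof -
  define U where "U = uniform_on d M"
  obtain g where g[measurable]: "g \<in> borel_measurable borel" and bg: "\<And>y. y \<in> M \<Longrightarrow> b \<le> g y"
    and Qg: "Q = density U (\<lambda>y. ennreal (g y))" and "prob_space Q"
    using Q by (auto simp: dists_on_def U_def)
  interpret prob_space Q by fact
  have sU [measurable_cong]: "sets U = sets borel"
    by (simp add: U_def uniform_on_def sets_hausdorff_measure)
  then show sQ: "sets Q = sets borel" by (simp add: Qg)
  have spU: "space U = UNIV" using sets_eq_imp_space_eq[OF sU] by simp
  have emU: "emeasure U A = emeasure (hausdorff_measure d) (M \<inter> A) / emeasure (hausdorff_measure d) M"
    if "A \<in> sets borel" for A
    unfolding U_def uniform_on_def using that M
    by (intro emeasure_uniform_measure) (simp_all add: sets_hausdorff_measure)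
  \<comment> \<open>The conventions \<open>0 / 0 = 0\<close> and \<open>\<infinity> / \<infinity> = 0\<close> make \<open>U\<close> the null measure if the Hausdorff measure of
    \<open>M\<close> is zero or infinite.\<close>
  have "emeasure U UNIV \<noteq> 0"
  proof
    assume "emeasure U UNIV = 0"
    then have "emeasure Q UNIV = 0"
      using g spU by (auto simp: Qg emeasure_density nn_integral_0_iff_AE intro!: AE_I[where N = UNIV])
    then show False using emeasure_space_1 sets_eq_imp_space_eq[OF sQ] by simp
  qed
  then have H0: "emeasure (hausdorff_measure d) M \<noteq> 0" using emU[of UNIV] by auto
  note H = emeasure_hausdorff_measure_eq_outer[OF H0]
  show "hausdorff_outer d M \<noteq> 0" using H0 H[OF M] by simp
  have "emeasure U (- M) = 0" using emU[of "- M"] M by simp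
  then have AE_U: "AE y in U. y \<in> M"
    using M sU spU by (intro AE_I[where N = "- M"]) (auto simp: borel_comp)
  then show "AE y in Q. y \<in> M"
    unfolding Qg by (subst AE_density) auto
  fix A :: "'a set" assume A[measurable]: "A \<in> sets borel"
  have "ennreal b * emeasure U A = (\<integral>\<^sup>+ y. ennreal b * indicator A y \<partial>U)"
    using A sU by (subst nn_integral_cmult_indicator) auto
  also have "\<dots> \<le> (\<integral>\<^sup>+ y. ennreal (g y) * indicator A y \<partial>U)"
    using AE_U by (intro nn_integral_mono_AE) (auto elim!: eventually_mono intro!: mult_right_mono ennreal_leI bg)
  also have "\<dots> = emeasure Q A" unfolding Qg using A by (subst emeasure_density) (auto simp: sU)
  finally show "ennreal b * (hausdorff_outer d (M \<inter> A) / hausdorff_outer d M) \<le> emeasure Q A"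
    using emU[OF A] H[OF M] H[of "M \<inter> A"] M A by auto
qed

lemma (in reach_manifold) emeasure_ball_ge:
  assumes Q: "Q \<in> dists_on d b B M" and b: "0 < b" and d: "0 < d" "d \<le> DIM('a)"
    and R: "M \<subseteq> cball 0 R" "0 \<le> R" and x: "x \<in> M" and r: "0 < r" "r \<le> \<kappa> / 100"
  shows "ennreal (b / (2 ^ d * packing_bound DIM('a) d \<kappa> R * (2 * real d) ^ d) * r ^ d) \<le> emeasure Q (ball x r)"
proof -
  have Mb: "M \<in> sets borel" using closed_M by simp
  note facts = dists_on_basic[OF Q Mb b]
  define p where "p = 2 ^ d * packing_bound DIM('a) d \<kappa> R"
  have p: "0 < p" using R(2) \<kappa>_pos by (simp add: p_def packing_bound_def)
  have up: "hausdorff_outer d M \<le> ennreal p" unfolding p_def by (rule hausdorff_outer_le[OF d R(1)])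
  obtain h where h: "hausdorff_outer d M = ennreal h" "0 \<le> h"
    using up by (cases "hausdorff_outer d M") (auto simp: top_unique)
  have h0: "0 < h" "h \<le> p" using h up facts(4) p by (simp_all add: ennreal_le_iff order.strict_iff_order)
  have "b / (p * (2 * real d) ^ d) * r ^ d = b * ((r / (2 * d)) ^ d / p)"
  proof -
    have "(r / (2 * d)) ^ d = r ^ d / (2 * real d) ^ d" by (simp only: power_divide of_nat_mult of_nat_numeral)
    then show ?thesis by (simp only: divide_divide_eq_left times_divide_eq_left times_divide_eq_right mult.commute)
  qed
  also have "\<dots> \<le> b * ((r / (2 * d)) ^ d / h)"
    using h0 b r by (intro mult_left_mono divide_left_mono) auto
  finally have "ennreal (b / (p * (2 * real d) ^ d) * r ^ d) \<le> ennreal b * (ennreal ((r / (2 * d)) ^ d) / ennreal h)"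
    using h0 b r by (simp add: divide_ennreal ennreal_leI flip: ennreal_mult)
  also have "\<dots> \<le> ennreal b * (hausdorff_outer d (M \<inter> ball x r) / hausdorff_outer d M)"
    unfolding h(1) by (intro mult_left_mono divide_right_mono_ennreal hausdorff_outer_ball_ge x d r) auto
  also have "\<dots> \<le> emeasure Q (ball x r)" by (rule facts(3)) auto
  finally show ?thesis by (simp only: p_def)
qed

section \<open>The estimator and its risk\<close>

text \<open>
  Sets that meet the same balls of a finite cover of \<open>K\<close> by balls of radius \<open>\<eta> / 2\<close> are \<open>\<eta>\<close>-close. One
  representative for each occurring collection of balls suffices.
\<close>
lemma finite_hausdorff_net:
  fixes \<M> :: "'a::euclidean_space set set"
  assumes K: "compact K" "\<And>M. M \<in> \<M> \<Longrightarrow> M \<subseteq> K" and \<eta>: "0 < \<eta>"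
  obtains \<F> where "finite \<F>" "\<F> \<subseteq> \<M>"
    "\<And>M. M \<in> \<M> \<Longrightarrow> \<exists>F\<in>\<F>. (\<forall>x\<in>M. \<exists>y\<in>F. dist x y < \<eta>) \<and> (\<forall>y\<in>F. \<exists>x\<in>M. dist y x < \<eta>)"
proof -
  obtain k where k: "finite k" "K \<subseteq> (\<Union>c\<in>k. ball c (\<eta> / 2))"
    using K(1) half_gt_zero[OF \<eta>] unfolding compact_eq_totally_bounded by meson
  define cells where "cells M = {c \<in> k. M \<inter> ball c (\<eta> / 2) \<noteq> {}}" for M
  have "finite (cells ` \<M>)" 
  proof (rule finite_subset)
    show "cells ` \<M> \<subseteq> Pow k" by (auto simp: cells_def)
  qed (use k(1) in simp)
  then obtain \<F> where \<F>: "\<F> \<subseteq> \<M>" "finite \<F>" "cells ` \<M> = cells ` \<F>"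
    using finite_subset_image[of "cells ` \<M>" cells \<M>] by blast
  have close: "\<exists>y\<in>F. dist x y < \<eta>" if MF: "cells M = cells F" "M \<in> \<M>" "x \<in> M" for M F x
  proof -
    obtain c where c: "c \<in> k" "dist c x < \<eta> / 2" using k(2) K(2)[OF MF(2)] MF(3) by auto
    then have "c \<in> cells M" using MF(3) by (auto simp: cells_def)
    then have "c \<in> cells F" using MF(1) by simp
    then obtain y where "y \<in> F" "dist c y < \<eta> / 2" by (auto simp: cells_def)
    then show ?thesis using c(2) dist_triangle3[of x y c] by force
  qed
  show ?thesis
  proof (rule that[OF \<F>(2,1)])
    fix M assume M: "M \<in> \<M>"
    then obtain F where F: "F \<in> \<F>" "cells M = cells F" using \<F>(3) by blast
    moreover have "F \<in> \<M>" using F \<F> by blast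
    ultimately show "\<exists>F\<in>\<F>. (\<forall>x\<in>M. \<exists>y\<in>F. dist x y < \<eta>) \<and> (\<forall>y\<in>F. \<exists>x\<in>M. dist y x < \<eta>)"
      using close[of M F] close[of F M] M by metis
  qed
qed

text \<open>
  The factor \<open>2\<close> makes room for the strict inequalities in the open enlargements.
\<close>
lemma hausdorff_dist_le:
  fixes A B :: "'a::metric_space set"
  assumes ne: "A \<noteq> {}" "B \<noteq> {}" and t: "0 < t"
    and AB: "\<And>x. x \<in> A \<Longrightarrow> infdist x B \<le> t" and BA: "\<And>x. x \<in> B \<Longrightarrow> infdist x A \<le> t"
  shows "hausdorff_dist A B \<le> ennreal (2 * t)"
  unfolding hausdorff_dist_def
proof (rule Inf_lower, rule CollectI, intro exI conjI)
  show "A \<subseteq> enlargement B (2 * t)"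
    using AB t infdist_less_iff_enlargement[OF ne(2), of _ "2 * t"] by force
  show "B \<subseteq> enlargement A (2 * t)"
    using BA t infdist_less_iff_enlargement[OF ne(1), of _ "2 * t"] by force
qed (use t in auto)

definition fits :: "nat \<Rightarrow> real \<Rightarrow> real \<Rightarrow> 'a::euclidean_space set \<Rightarrow> (nat \<Rightarrow> 'a) \<Rightarrow> bool" where
  "fits n \<eta> \<rho> F y \<longleftrightarrow> (\<forall>i<n. infdist (y i) F \<le> \<eta>) \<and> (\<forall>x\<in>F. \<exists>i<n. dist x (y i) \<le> \<rho>)"

text \<open>
  If no candidate fits the sample, \<open>LEAST\<close> denotes some fixed index, so the estimate is still a member
  of the family and its error stays bounded.
\<close>
definition first_fit ::
    "nat \<Rightarrow> real \<Rightarrow> real \<Rightarrow> (nat \<Rightarrow> 'a::euclidean_space set) \<Rightarrow> (nat \<Rightarrow> 'a) \<Rightarrow> 'a set" where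
  "first_fit n \<eta> \<rho> F y = F (LEAST j. fits n \<eta> \<rho> (F j) y)"

text \<open>
  The quantifier over the possibly uncountable set \<open>F\<close> is reduced to a countable dense subset, because
  finite unions of closed balls are closed.
\<close>
lemma measurable_fits:
  fixes F :: "'a::euclidean_space set"
  shows "Measurable.pred (Pi\<^sub>M {..<n} (\<lambda>_. borel)) (fits n \<eta> \<rho> F)"
proof -
  let ?N = "Pi\<^sub>M {..<n} (\<lambda>_. borel) :: (nat \<Rightarrow> 'a) measure"
  obtain T where T: "countable T" "T \<subseteq> F" "F \<subseteq> closure T"
    by (rule separable)
  have dense: "(\<forall>x\<in>F. \<exists>i<n. dist x (y i) \<le> \<rho>) \<longleftrightarrow> (\<forall>x\<in>T. \<exists>i\<in>{..<n}. dist x (y i) \<le> \<rho>)" for y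
  proof
    assume T_near: "\<forall>x\<in>T. \<exists>i\<in>{..<n}. dist x (y i) \<le> \<rho>"
    have "closed (\<Union>i\<in>{..<n}. cball (y i) \<rho>)" by (intro closed_UN) auto
    moreover have "T \<subseteq> (\<Union>i\<in>{..<n}. cball (y i) \<rho>)" using T_near by (auto simp: dist_commute)
    ultimately have "F \<subseteq> (\<Union>i\<in>{..<n}. cball (y i) \<rho>)" using T(3) closure_minimal by blast
    then show "\<forall>x\<in>F. \<exists>i<n. dist x (y i) \<le> \<rho>" by (force simp: dist_commute)
  qed (use T(2) in auto)
  have fits_eq: "fits n \<eta> \<rho> F =
      (\<lambda>y. (\<forall>i\<in>{..<n}. infdist (y i) F \<le> \<eta>) \<and> (\<forall>x\<in>T. \<exists>i\<in>{..<n}. dist x (y i) \<le> \<rho>))"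
    unfolding fits_def dense by auto
  have inf [measurable]: "(\<lambda>z. infdist z F) \<in> borel_measurable borel"
    by (intro borel_measurable_continuous_onI continuous_intros)
  have "Measurable.pred ?N (\<lambda>y. infdist (y i) F \<le> \<eta>)" if "i \<in> {..<n}" for i
  proof -
    have [measurable]: "(\<lambda>y. y i) \<in> measurable ?N borel" by (rule measurable_component_singleton[OF that])
    show ?thesis by measurable
  qed
  moreover have "Measurable.pred ?N (\<lambda>y. dist x (y i) \<le> \<rho>)" if "i \<in> {..<n}" for i x
  proof -
    have [measurable]: "(\<lambda>y. y i) \<in> measurable ?N borel" by (rule measurable_component_singleton[OF that])
    show ?thesis by measurable
  qed
  ultimately have "Measurable.pred ?N (\<lambda>y. \<forall>i\<in>{..<n}. infdist (y i) F \<le> \<eta>)"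
    "Measurable.pred ?N (\<lambda>y. \<forall>x\<in>T. \<exists>i\<in>{..<n}. dist x (y i) \<le> \<rho>)"
    using T(1) by (auto intro!: pred_intros_finite pred_intros_countable_bounded)
  then show ?thesis unfolding fits_eq by (rule pred_intros_logic)
qed

lemma first_fit_in_estimators: "first_fit n \<eta> \<rho> F \<in> estimators n"
  unfolding estimators_def
proof (intro CollectI allI impI)
  fix A :: "'a set"
  let ?N = "Pi\<^sub>M {..<n} (\<lambda>_. borel) :: (nat \<Rightarrow> 'a) measure"
  have "(\<lambda>y. LEAST j. fits n \<eta> \<rho> (F j) y) \<in> measurable ?N (count_space UNIV)"
    by (intro measurable_Least measurable_fits)
  then show "(\<lambda>y. hausdorff_dist (first_fit n \<eta> \<rho> F y) A) \<in> borel_measurable ?N"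
    unfolding first_fit_def by (rule measurable_compose) simp
qed

text \<open>
  The candidate close to \<open>M\<close> fits the sample, so the selected candidate \<open>G\<close> fits it too. The sample
  itself is a net of \<open>M\<close> near \<open>G\<close>, and its projection to \<open>G\<close> is a net of \<open>G\<close> near \<open>M\<close>; the stability
  estimate applies in both directions.
\<close>
lemma first_fit_error_le:
  assumes M: "reach_manifold M \<kappa> d" and F: "\<And>j. reach_manifold (F j) \<kappa> d"
    and approx: "(\<forall>x\<in>M. \<exists>z\<in>F j. dist x z < \<eta>)" "(\<forall>z\<in>F j. \<exists>x\<in>M. dist z x < \<eta>)"
    and y: "\<And>i. i < n \<Longrightarrow> y i \<in> M" and net: "\<And>x. x \<in> M \<Longrightarrow> \<exists>i<n. dist x (y i) \<le> \<epsilon>"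
    and small: "0 \<le> \<epsilon>" "0 < \<eta>" "\<epsilon> + 3 * \<eta> \<le> \<kappa> / 2"
  shows "hausdorff_dist (first_fit n \<eta> (\<epsilon> + \<eta>) F y) M \<le> ennreal (2 * (\<eta> + 5 / (2 * \<kappa>) * (\<epsilon> + 2 * \<eta>)\<^sup>2))"
proof -
  have "fits n \<eta> (\<epsilon> + \<eta>) (F j) y"
    unfolding fits_def
  proof (intro conjI allI impI ballI)
    fix i assume "i < n"
    then obtain z where "z \<in> F j" "dist (y i) z < \<eta>" using approx(1) y by blast
    then show "infdist (y i) (F j) \<le> \<eta>" using infdist_le[of z "F j" "y i"] by simp
  next
    fix z assume "z \<in> F j"
    then obtain x where "x \<in> M" "dist z x < \<eta>" using approx(2) by blast
    moreover then obtain i where "i < n" "dist x (y i) \<le> \<epsilon>" using net by blast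
    ultimately show "\<exists>i<n. dist z (y i) \<le> \<epsilon> + \<eta>" using dist_triangle[of z "y i" x] by force
  qed
  then have fit: "fits n \<eta> (\<epsilon> + \<eta>) (first_fit n \<eta> (\<epsilon> + \<eta>) F y) y"
    unfolding first_fit_def by (rule LeastI)
  define G where "G = first_fit n \<eta> (\<epsilon> + \<eta>) F y"
  have G: "reach_manifold G \<kappa> d" using F by (simp add: G_def first_fit_def)
  interpret M: reach_manifold M \<kappa> d by fact
  interpret G: reach_manifold G \<kappa> d by fact
  let ?\<rho> = "\<epsilon> + 2 * \<eta>"
  let ?t = "\<eta> + 5 / (2 * \<kappa>) * ?\<rho>\<^sup>2"
  have "infdist x G \<le> ?t" if "x \<in> M" for x
  proof (rule M.infdist_le_of_near_net[OF G.positive_reach_axioms _ _ that])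
    show "\<exists>z\<in>M. dist x z \<le> ?\<rho> \<and> infdist z G \<le> \<eta>" if xM: "x \<in> M" for x
    proof -
      obtain i where "i < n" "dist x (y i) \<le> \<epsilon>" using net[OF xM] by blast
      then show ?thesis using y fit small by (intro bexI[of _ "y i"]) (auto simp: fits_def G_def)
    qed
  qed (use small in simp)
  moreover have "infdist x M \<le> ?t" if "x \<in> G" for x
  proof (rule G.infdist_le_of_near_net[OF M.positive_reach_axioms _ _ that])
    show "\<exists>z\<in>G. dist x z \<le> ?\<rho> \<and> infdist z M \<le> \<eta>" if xG: "x \<in> G" for x
    proof -
      obtain i where i: "i < n" "dist x (y i) \<le> \<epsilon> + \<eta>" using fit xG by (auto simp: fits_def G_def)
      have yG: "dist (y i) (G.proj (y i)) \<le> \<eta>"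
        unfolding G.dist_proj using fit i(1) by (simp add: fits_def G_def)
      then have "dist x (G.proj (y i)) \<le> ?\<rho>"
        using i(2) dist_triangle[of x "G.proj (y i)" "y i"] by simp
      moreover have "infdist (G.proj (y i)) M \<le> \<eta>"
        using infdist_le[OF y[OF i(1)], of "G.proj (y i)"] yG by (simp add: dist_commute)
      ultimately show ?thesis using G.proj_in by blast
    qed
  qed (use small in simp)
  moreover have "0 < ?t" using small M.\<kappa>_pos by (simp add: add_pos_nonneg)
  ultimately show ?thesis
    unfolding G_def[symmetric] using M.M_nonempty G.M_nonempty by (intro hausdorff_dist_le) auto
qed

text \<open>
  The union bound over \<open>P\<close>, with \<open>(1 - q)\<^sup>n \<le> exp (- n q)\<close> for each point. The exceptional set is
  a finite union of boxes and hence measurable.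
\<close>
lemma sample_covers_net:
  fixes Q :: "'a::euclidean_space measure"
  assumes Q: "prob_space Q" "sets Q = sets borel" and P: "finite P"
    and mass: "\<And>p. p \<in> P \<Longrightarrow> ennreal q \<le> emeasure Q (ball p r)" and q: "0 \<le> q"
  obtains Bad where "Bad \<in> sets (Pi\<^sub>M {..<n} (\<lambda>_. Q))"
    "emeasure (Pi\<^sub>M {..<n} (\<lambda>_. Q)) Bad \<le> ennreal (real (card P) * exp (- (real n * q)))"
    "\<And>y p. y \<in> space (Pi\<^sub>M {..<n} (\<lambda>_. Q)) \<Longrightarrow> y \<notin> Bad \<Longrightarrow> p \<in> P \<Longrightarrow> \<exists>i<n. dist p (y i) < r"
proof -
  interpret Q: prob_space Q by fact
  interpret product_sigma_finite "\<lambda>_::nat. Q" ..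
  let ?N = "Pi\<^sub>M {..<n} (\<lambda>_. Q)"
  have spQ: "space Q = UNIV" using sets_eq_imp_space_eq[OF Q(2)] by simp
  define miss where "miss p = Pi\<^sub>E {..<n} (\<lambda>_. - ball p r)" for p :: 'a
  have miss_sets: "miss p \<in> sets ?N" for p
    unfolding miss_def by (intro sets_PiM_I_finite) (auto simp: Q(2))
  have miss_prob: "emeasure ?N (miss p) \<le> ennreal (exp (- (real n * q)))" if p: "p \<in> P" for p
  proof -
    have ballQ: "ball p r \<in> sets Q" by (simp add: Q(2))
    have "q \<le> Q.prob (ball p r)"
      using mass[OF p] by (simp add: Q.emeasure_eq_measure)
    moreover have "Q.prob (- ball p r) = 1 - Q.prob (ball p r)"
      using Q.prob_compl[OF ballQ] by (simp add: spQ Compl_eq_Diff_UNIV)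
    moreover have "1 - q \<le> exp (- q)" using exp_ge_add_one_self[of "- q"] by simp
    ultimately have "Q.prob (- ball p r) \<le> exp (- q)" by linarith
    then have "emeasure Q (- ball p r) \<le> ennreal (exp (- q))"
      by (simp add: Q.emeasure_eq_measure ennreal_leI)
    then have "emeasure Q (- ball p r) ^ n \<le> ennreal (exp (- q)) ^ n" by (intro power_mono) auto
    moreover have "emeasure ?N (miss p) = emeasure Q (- ball p r) ^ n"
      unfolding miss_def by (subst emeasure_PiM) (auto simp: Q(2))
    ultimately show ?thesis by (simp add: ennreal_power exp_of_nat_mult[symmetric])
  qed
  show ?thesis
  proof (rule that[of "\<Union>p\<in>P. miss p"])
    show "(\<Union>p\<in>P. miss p) \<in> sets ?N" using P miss_sets by auto
    have "emeasure ?N (\<Union>p\<in>P. miss p) \<le> (\<Sum>p\<in>P. emeasure ?N (miss p))"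
      using P miss_sets by (intro emeasure_subadditive_finite) auto
    also have "\<dots> \<le> (\<Sum>p\<in>P. ennreal (exp (- (real n * q))))" by (intro sum_mono miss_prob)
    also have "\<dots> = ennreal (real (card P) * exp (- (real n * q)))"
      by (simp add: ennreal_mult ennreal_of_nat_eq_real_of_nat)
    finally show "emeasure ?N (\<Union>p\<in>P. miss p) \<le> ennreal (real (card P) * exp (- (real n * q)))" .
    fix y p assume y: "y \<in> space ?N" "y \<notin> (\<Union>p\<in>P. miss p)" and p: "p \<in> P"
    then have "y \<notin> miss p" "y \<in> extensional {..<n}" by (auto simp: space_PiM PiE_def)
    then show "\<exists>i<n. dist p (y i) < r" by (auto simp: miss_def PiE_def Pi_def)
  qed
qed

lemma hausdorff_dist_le_of_subset_cball:
  fixes A B :: "'a::euclidean_space set"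
  assumes A: "A \<noteq> {}" "A \<subseteq> cball 0 R" and B: "B \<noteq> {}" "B \<subseteq> cball 0 R" and R: "0 \<le> R"
  shows "hausdorff_dist A B \<le> ennreal (2 * (2 * R + 1))"
proof (rule hausdorff_dist_le[OF A(1) B(1)])
  have near: "infdist x T \<le> 2 * R + 1" if "x \<in> S" "S \<subseteq> cball 0 R" "T \<subseteq> cball 0 R" "T \<noteq> {}"
    for x and S T :: "'a set"
  proof -
    obtain z where z: "z \<in> T" using \<open>T \<noteq> {}\<close> by blast
    have "norm x \<le> R" "norm z \<le> R" using that z by auto
    then have "dist x z \<le> 2 * R" using norm_triangle_ineq4[of x z] by (simp add: dist_norm)
    then show ?thesis using infdist_le[OF z, of x] by simp
  qed
  show "infdist x B \<le> 2 * R + 1" if "x \<in> A" for x using near[OF that A(2) B(2,1)] .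
  show "infdist x A \<le> 2 * R + 1" if "x \<in> B" for x using near[OF that B(2) A(2,1)] .
qed (use R in simp)

text \<open>
  On the event that every ball of radius \<open>\<epsilon> / 2\<close> around a point of an \<open>\<epsilon> / 2\<close>-net of \<open>M\<close> contains an
  observation, the sample is \<open>\<epsilon>\<close>-dense and the error is small. On the complement the error is at
  most \<open>2 (2 R + 1)\<close>.
\<close>
lemma first_fit_risk_le:
  fixes M :: "'a::euclidean_space set"
  assumes M: "reach_manifold M \<kappa> d" and F: "\<And>j. reach_manifold (F j) \<kappa> d"
    and Q: "Q \<in> dists_on d b B M" and b: "0 < b" and d: "0 < d" "d \<le> DIM('a)"
    and R: "M \<subseteq> cball 0 R" "\<And>j. F j \<subseteq> cball 0 R" "0 \<le> R"
    and approx: "(\<forall>x\<in>M. \<exists>z\<in>F j. dist x z < \<eta>)" "(\<forall>z\<in>F j. \<exists>x\<in>M. dist z x < \<eta>)"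
    and small: "0 < \<epsilon>" "0 < \<eta>" "\<epsilon> \<le> \<kappa> / 50" "\<epsilon> + 3 * \<eta> \<le> \<kappa> / 2"
    and pb: "pb = packing_bound DIM('a) d \<kappa> R" and q0: "q0 = b / (2 ^ d * pb * (2 * real d) ^ d)"
  shows "(\<integral>\<^sup>+ y. hausdorff_dist (first_fit n \<eta> (\<epsilon> + \<eta>) F y) M \<partial>(Pi\<^sub>M {..<n} (\<lambda>_. Q)))
    \<le> ennreal (2 * (\<eta> + 5 / (2 * \<kappa>) * (\<epsilon> + 2 * \<eta>)\<^sup>2) +
        2 * (2 * R + 1) * (pb / (\<epsilon> / 2) ^ d * exp (- (real n * (q0 * (\<epsilon> / 2) ^ d)))))"
proof -
  interpret M: reach_manifold M \<kappa> d by fact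
  have prob: "prob_space Q" using Q by (simp add: dists_on_def)
  interpret prob_space Q by fact
  have Mb: "M \<in> sets borel" using M.closed_M by simp
  note facts = dists_on_basic[OF Q Mb b]
  let ?N = "Pi\<^sub>M {..<n} (\<lambda>_. Q)"
  interpret N: prob_space ?N by (intro prob_space_PiM prob)
  let ?r = "\<epsilon> / 2" and ?q = "q0 * (\<epsilon> / 2) ^ d"
  let ?h = "2 * (\<eta> + 5 / (2 * \<kappa>) * (\<epsilon> + 2 * \<eta>)\<^sup>2)" and ?D = "2 * (2 * R + 1)"
  have pb0: "0 < pb" using R(3) M.\<kappa>_pos by (simp add: pb packing_bound_def)
  then have q00: "0 < q0" using b d by (simp add: q0)
  obtain P where P: "finite P" "P \<subseteq> M" "real (card P) * ?r ^ d \<le> pb"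
      "\<And>x. x \<in> M \<Longrightarrow> \<exists>p\<in>P. dist x p < ?r"
    using M.finite_net[OF _ _ R(1) d(2), of ?r] small M.\<kappa>_pos unfolding pb by auto
  have mass: "ennreal ?q \<le> emeasure Q (ball p ?r)" if "p \<in> P" for p
    unfolding q0 pb using small P(2) that by (intro M.emeasure_ball_ge[OF Q b d R(1,3)]) auto
  have "0 \<le> ?q" using q00 small by simp
  obtain Bad where Bad: "Bad \<in> sets ?N" "emeasure ?N Bad \<le> ennreal (real (card P) * exp (- (real n * ?q)))"
    and cov: "\<And>y p. y \<in> space ?N \<Longrightarrow> y \<notin> Bad \<Longrightarrow> p \<in> P \<Longrightarrow> \<exists>i<n. dist p (y i) < ?r"
    by (rule sample_covers_net[OF prob facts(1) P(1) mass \<open>0 \<le> ?q\<close>, of n]) (assumption, erule (1) that, blast)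
  have in_M: "AE y in ?N. \<forall>i\<in>{..<n}. y i \<in> M"
    using facts(2) prob by (intro AE_finite_allI AE_PiM_component) auto
  have trivial: "hausdorff_dist (first_fit n \<eta> (\<epsilon> + \<eta>) F y) M \<le> ennreal ?D" for y
  proof -
    define G where "G = first_fit n \<eta> (\<epsilon> + \<eta>) F y"
    interpret G: reach_manifold G \<kappa> d using F by (simp add: G_def first_fit_def)
    have GR: "G \<subseteq> cball 0 R" using R by (simp add: G_def first_fit_def)
    show ?thesis unfolding G_def[symmetric]
      by (rule hausdorff_dist_le_of_subset_cball[OF G.M_nonempty GR M.M_nonempty R(1,3)])
  qed
  have "(\<integral>\<^sup>+ y. hausdorff_dist (first_fit n \<eta> (\<epsilon> + \<eta>) F y) M \<partial>?N)
      \<le> (\<integral>\<^sup>+ y. ennreal ?h + ennreal ?D * indicator Bad y \<partial>?N)"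
  proof (rule nn_integral_mono_AE)
    show "AE y in ?N. hausdorff_dist (first_fit n \<eta> (\<epsilon> + \<eta>) F y) M \<le> ennreal ?h + ennreal ?D * indicator Bad y"
      using in_M AE_space
    proof eventually_elim
      case (elim y)
      show ?case
      proof (cases "y \<in> Bad")
        case True
        then show ?thesis using trivial[of y] by (simp add: add_increasing)
      next
        case False
        have "\<exists>i<n. dist x (y i) \<le> \<epsilon>" if "x \<in> M" for x
        proof -
          obtain p where p: "p \<in> P" "dist x p < ?r" using P(4)[OF \<open>x \<in> M\<close>] by blast
          obtain i where "i < n" "dist p (y i) < ?r" using cov[OF elim(2) False p(1)] by blast
          then show ?thesis using p(2) dist_triangle[of x "y i" p] by force
        qed
        then have "hausdorff_dist (first_fit n \<eta> (\<epsilon> + \<eta>) F y) M \<le> ennreal ?h"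
          using elim(1) small by (intro first_fit_error_le[where F = F and j = j, OF M F approx]) auto
        then show ?thesis using False by simp
      qed
    qed
  qed
  also have "\<dots> = ennreal ?h + ennreal ?D * emeasure ?N Bad"
    using Bad(1) by (subst nn_integral_add) (auto simp: nn_integral_cmult_indicator N.emeasure_space_1)
  also have "\<dots> \<le> ennreal ?h + ennreal ?D * ennreal (pb / ?r ^ d * exp (- (real n * ?q)))"
  proof (intro add_left_mono mult_left_mono order_trans[OF Bad(2)] ennreal_leI mult_right_mono)
    show "real (card P) \<le> pb / ?r ^ d" using P(3) small by (simp add: pos_le_divide_eq)
  qed auto
  also have "\<dots> = ennreal (?h + ?D * (pb / ?r ^ d * exp (- (real n * ?q))))"
  proof -
    have "0 \<le> ?h" using small M.\<kappa>_pos by simp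
    moreover have "0 \<le> ?D" using R(3) by simp
    moreover have "0 \<le> pb / ?r ^ d * exp (- (real n * ?q))" using pb0 small by simp
    ultimately show ?thesis by (simp only: ennreal_mult[symmetric] ennreal_plus[symmetric] mult_nonneg_nonneg)
  qed
  finally show ?thesis .
qed

section \<open>The rate\<close>

text \<open>
  The resolution is \<open>\<epsilon>\<^sup>d = A r\<close> with \<open>r = ln n / n\<close>. The choice \<open>A = 3 * 2\<^sup>d / q0\<close> turns the exponential
  into \<open>1 / n\<^sup>3\<close>; one factor of \<open>n\<close> is lost to the size of the net, and the remaining
  \<open>1 / n\<^sup>2\<close> is of order at most \<open>r\<^sup>2 \<le> r powr (2 / d)\<close>. For the finitely many \<open>n\<close> with \<open>\<epsilon>\<close> too large for
  the geometric estimates, \<open>r\<close> is bounded below and a constant risk bound is good enough; this is the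
  first alternative.
\<close>
lemma resolution_tradeoff:
  fixes d :: nat and \<kappa> R q0 pb :: real
  assumes d: "1 \<le> d" and pos: "0 < \<kappa>" "0 \<le> R" "0 < q0" "0 < pb"
  obtains C where "0 < C"
    "\<And>n :: nat. 2 \<le> n \<Longrightarrow>
       2 * (2 * R + 1) \<le> C * (ln (real n) / real n) powr (2 / real d) \<or>
       (\<exists>\<epsilon>>0. \<epsilon> \<le> \<kappa> / 50 \<and> \<epsilon> + 3 * \<epsilon>\<^sup>2 \<le> \<kappa> / 2 \<and>
          2 * (\<epsilon>\<^sup>2 + 5 / (2 * \<kappa>) * (\<epsilon> + 2 * \<epsilon>\<^sup>2)\<^sup>2) +
            2 * (2 * R + 1) * (pb / (\<epsilon> / 2) ^ d * exp (- (real n * (q0 * (\<epsilon> / 2) ^ d))))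
          \<le> C * (ln (real n) / real n) powr (2 / real d))"
proof -
  define L where "L = 2 * (2 * R + 1)"
  have L: "0 < L" using pos by (simp add: L_def)
  \<comment> \<open>Below \<open>\<epsilon>0\<close> both \<open>\<epsilon>\<^sup>2 \<le> \<epsilon>\<close> and \<open>\<epsilon> + 3 * \<epsilon>\<^sup>2 \<le> 4 * \<epsilon> \<le> \<kappa> / 2\<close>.\<close>
  define \<epsilon>0 where "\<epsilon>0 = min 1 (\<kappa> / 50)"
  have \<epsilon>0: "0 < \<epsilon>0" "\<epsilon>0 \<le> 1" "\<epsilon>0 \<le> \<kappa> / 50" using pos by (auto simp: \<epsilon>0_def)
  define A where "A = 3 * 2 ^ d / q0"
  have A: "0 < A" using pos by (simp add: A_def)
  define p where "p = 2 / real d"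
  have p: "0 < p" "p \<le> 2" using d by (auto simp: p_def divide_simps)
  define C1 where "C1 = 2 * (1 + 45 / (2 * \<kappa>)) * A powr p"
  define C2 where "C2 = L * (pb * q0 / 3) / (ln 2) ^ 3"
  define C3 where "C3 = L / (\<epsilon>0 ^ d / A) powr p"
  have C1: "0 \<le> C1" using pos by (simp add: C1_def)
  have C2: "0 \<le> C2" using pos L by (simp add: C2_def)
  have C3: "0 < C3" using A \<epsilon>0 L by (simp add: C3_def)
  show ?thesis
  proof (rule that[of "C1 + C2 + C3"])
    show "0 < C1 + C2 + C3" using C1 C2 C3 by simp
    fix n :: nat assume n: "2 \<le> n"
    define r where "r = ln (real n) / real n"
    have ln2: "0 < ln (2::real)" "ln 2 \<le> ln (real n)" using n by auto
    have r: "0 < r" "r \<le> 1"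
      using n ln2 ln_le_minus_one[of "real n"] by (auto simp: r_def divide_simps)
    define \<epsilon> where "\<epsilon> = (A * r) powr (1 / real d)"
    have \<epsilon>pos: "0 < \<epsilon>" using A r by (simp add: \<epsilon>_def)
    have \<epsilon>d: "\<epsilon> ^ d = A * r"
      using A r d by (simp add: \<epsilon>_def powr_powr flip: powr_realpow)
    show "2 * (2 * R + 1) \<le> (C1 + C2 + C3) * (ln (real n) / real n) powr (2 / real d) \<or>
       (\<exists>\<epsilon>>0. \<epsilon> \<le> \<kappa> / 50 \<and> \<epsilon> + 3 * \<epsilon>\<^sup>2 \<le> \<kappa> / 2 \<and>
          2 * (\<epsilon>\<^sup>2 + 5 / (2 * \<kappa>) * (\<epsilon> + 2 * \<epsilon>\<^sup>2)\<^sup>2) +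
            2 * (2 * R + 1) * (pb / (\<epsilon> / 2) ^ d * exp (- (real n * (q0 * (\<epsilon> / 2) ^ d))))
          \<le> (C1 + C2 + C3) * (ln (real n) / real n) powr (2 / real d))"
      unfolding r_def[symmetric] p_def[symmetric] L_def[symmetric]
    proof (cases "\<epsilon> \<le> \<epsilon>0")
      case False
      then have "\<epsilon>0 ^ d \<le> \<epsilon> ^ d" using \<epsilon>0 by (intro power_mono) auto
      then have "\<epsilon>0 ^ d / A \<le> r" using A by (simp add: \<epsilon>d field_simps)
      then have le: "(\<epsilon>0 ^ d / A) powr p \<le> r powr p" using A \<epsilon>0 p by (intro powr_mono2) auto
      have "L = C3 * (\<epsilon>0 ^ d / A) powr p" using A \<epsilon>0 by (simp add: C3_def)
      also have "\<dots> \<le> C3 * r powr p" using le C3 by (intro mult_left_mono) auto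
      also have "\<dots> \<le> (C1 + C2 + C3) * r powr p" using C1 C2 by (intro mult_right_mono) auto
      finally show "L \<le> (C1 + C2 + C3) * r powr p \<or>
       (\<exists>\<epsilon>>0. \<epsilon> \<le> \<kappa> / 50 \<and> \<epsilon> + 3 * \<epsilon>\<^sup>2 \<le> \<kappa> / 2 \<and>
          2 * (\<epsilon>\<^sup>2 + 5 / (2 * \<kappa>) * (\<epsilon> + 2 * \<epsilon>\<^sup>2)\<^sup>2) +
            L * (pb / (\<epsilon> / 2) ^ d * exp (- (real n * (q0 * (\<epsilon> / 2) ^ d))))
          \<le> (C1 + C2 + C3) * r powr p)" ..
    next
      case True
      have sq: "\<epsilon>\<^sup>2 \<le> \<epsilon>" using True \<epsilon>0 \<epsilon>pos by (simp add: power2_eq_square mult_left_le)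
      have \<epsilon>2: "\<epsilon>\<^sup>2 = A powr p * r powr p"
      proof -
        have "\<epsilon>\<^sup>2 = \<epsilon> powr 2" using \<epsilon>pos by simp
        also have "\<dots> = (A * r) powr p" by (simp add: \<epsilon>_def powr_powr p_def)
        also have "\<dots> = A powr p * r powr p" using A r by (simp add: powr_mult)
        finally show ?thesis .
      qed
      have "(\<epsilon> + 2 * \<epsilon>\<^sup>2)\<^sup>2 \<le> (3 * \<epsilon>)\<^sup>2" using sq \<epsilon>pos by (intro power_mono) auto
      then have "2 * (\<epsilon>\<^sup>2 + 5 / (2 * \<kappa>) * (\<epsilon> + 2 * \<epsilon>\<^sup>2)\<^sup>2) \<le> 2 * (\<epsilon>\<^sup>2 + 5 / (2 * \<kappa>) * (3 * \<epsilon>)\<^sup>2)"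
        using pos by (intro mult_left_mono add_left_mono) simp_all
      also have "\<dots> = 2 * (1 + 45 / (2 * \<kappa>)) * \<epsilon>\<^sup>2" by (simp add: power_mult_distrib distrib_right)
      also have "\<dots> = C1 * r powr p" by (simp add: C1_def \<epsilon>2 mult.assoc)
      finally have bias: "2 * (\<epsilon>\<^sup>2 + 5 / (2 * \<kappa>) * (\<epsilon> + 2 * \<epsilon>\<^sup>2)\<^sup>2) \<le> C1 * r powr p" .
      have half: "(\<epsilon> / 2) ^ d = 3 * r / q0"
        using \<epsilon>d by (simp add: power_divide A_def)
      have "exp (- (real n * (q0 * (\<epsilon> / 2) ^ d))) = exp (- (3 * ln (real n)))"
        using n pos by (simp add: half r_def)
      also have "\<dots> = 1 / real n ^ 3"
        using n by (simp add: exp_minus inverse_eq_divide exp_of_nat_mult[of 3 "ln (real n)", simplified])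
      finally have ex: "exp (- (real n * (q0 * (\<epsilon> / 2) ^ d))) = 1 / real n ^ 3" .
      have "pb / (\<epsilon> / 2) ^ d * exp (- (real n * (q0 * (\<epsilon> / 2) ^ d))) = pb * q0 / 3 * (1 / (r * real n ^ 3))"
        using pos by (simp only: ex) (simp add: half)
      also have "1 / (r * real n ^ 3) = (1 / ln (real n) ^ 3) * r\<^sup>2"
        using n ln2 by (simp add: r_def power2_eq_square power3_eq_cube)
      also have "\<dots> \<le> (1 / (ln 2) ^ 3) * r powr p"
      proof (intro mult_mono)
        show "1 / ln (real n) ^ 3 \<le> 1 / ln 2 ^ 3"
          using ln2 by (intro frac_le power_mono) auto
        have "r\<^sup>2 = r powr 2" using r by simp
        also have "\<dots> \<le> r powr p" using r p by (intro powr_mono') auto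
        finally show "r\<^sup>2 \<le> r powr p" .
      qed (use ln2 in auto)
      finally have "pb / (\<epsilon> / 2) ^ d * exp (- (real n * (q0 * (\<epsilon> / 2) ^ d))) \<le>
          pb * q0 / 3 * ((1 / (ln 2) ^ 3) * r powr p)"
        using pos by (simp add: mult_left_mono)
      then have "L * (pb / (\<epsilon> / 2) ^ d * exp (- (real n * (q0 * (\<epsilon> / 2) ^ d)))) \<le>
          L * (pb * q0 / 3 * ((1 / (ln 2) ^ 3) * r powr p))"
        using L by (intro mult_left_mono) auto
      also have "\<dots> = C2 * r powr p" by (simp add: C2_def)
      finally have variance: "L * (pb / (\<epsilon> / 2) ^ d * exp (- (real n * (q0 * (\<epsilon> / 2) ^ d)))) \<le> C2 * r powr p" .
      have "C1 * r powr p + C2 * r powr p \<le> (C1 + C2 + C3) * r powr p"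
        using C3 by (simp add: distrib_right)
      moreover have "\<epsilon> \<le> \<kappa> / 50" "\<epsilon> + 3 * \<epsilon>\<^sup>2 \<le> \<kappa> / 2" using True \<epsilon>0 sq pos by auto
      ultimately show "L \<le> (C1 + C2 + C3) * r powr p \<or>
       (\<exists>\<epsilon>>0. \<epsilon> \<le> \<kappa> / 50 \<and> \<epsilon> + 3 * \<epsilon>\<^sup>2 \<le> \<kappa> / 2 \<and>
          2 * (\<epsilon>\<^sup>2 + 5 / (2 * \<kappa>) * (\<epsilon> + 2 * \<epsilon>\<^sup>2)\<^sup>2) +
            L * (pb / (\<epsilon> / 2) ^ d * exp (- (real n * (q0 * (\<epsilon> / 2) ^ d))))
          \<le> (C1 + C2 + C3) * r powr p)"
        using \<epsilon>pos bias variance by (intro disjI2 exI[of _ \<epsilon>] conjI) linarith+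
    qed
  qed
qed

lemma minimax_risk_le:
  assumes "Mhat \<in> estimators n"
    and "\<And>M Q. M \<in> noiseless_manifolds d \<kappa> K \<Longrightarrow> Q \<in> dists_on d b B M \<Longrightarrow>
      (\<integral>\<^sup>+ y. hausdorff_dist (Mhat y) M \<partial>(Pi\<^sub>M {..<n} (\<lambda>_. Q))) \<le> c"
  shows "minimax_risk d \<kappa> K b B n \<le> c"
  unfolding minimax_risk_def
  by (rule INF_lower2[OF assms(1)], intro SUP_least) (use assms(2) in auto)

theorem theorem3:
  fixes d :: nat and \<kappa> b B :: real and K :: "'a::euclidean_space set"
  assumes "1 \<le> d" and "d < DIM('a)"
    and "0 < \<kappa>" and "compact K"
    and "0 < b" and "b \<le> B"
  shows "\<exists>C::real. 0 < C \<and>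
    (\<forall>n::nat. 2 \<le> n \<longrightarrow>
      minimax_risk d \<kappa> K b B n \<le> ennreal (C * (ln (real n) / real n) powr (2 / real d)))"
proof (cases "noiseless_manifolds d \<kappa> K = {}")
  case True
  then have "minimax_risk d \<kappa> K b B n \<le> c" for n c
    by (intro minimax_risk_le[OF first_fit_in_estimators]) auto
  then show ?thesis by (intro exI[of _ 1]) auto
next
  case False
  let ?\<M> = "noiseless_manifolds d \<kappa> K"
  have d: "0 < d" "d \<le> DIM('a)" using assms(1,2) by auto
  obtain R where R: "0 < R" "K \<subseteq> cball 0 R"
    using compact_imp_bounded[OF \<open>compact K\<close>] unfolding bounded_pos by (auto simp: subset_iff)
  have reach: "reach_manifold M \<kappa> d" if "M \<in> ?\<M>" for M
    using noiseless_manifold_reach_manifold[OF that assms(4,3)] .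
  have MK: "M \<subseteq> K" if "M \<in> ?\<M>" for M using that by (simp add: noiseless_manifolds_def)
  then have MR: "M \<subseteq> cball 0 R" if "M \<in> ?\<M>" for M using R that by blast
  have ne: "M \<noteq> {}" if "M \<in> ?\<M>" for M
    using that by (auto simp: noiseless_manifolds_def manifolds_def smooth_submanifold_def)
  define pb where "pb = packing_bound DIM('a) d \<kappa> R"
  define q0 where "q0 = b / (2 ^ d * pb * (2 * real d) ^ d)"
  have pb: "0 < pb" using R assms(3) by (simp add: pb_def packing_bound_def)
  have q0: "0 < q0" using pb d assms(5) by (simp add: q0_def)
  obtain C where C: "0 < C" and rate: "\<And>n :: nat. 2 \<le> n \<Longrightarrow>
       2 * (2 * R + 1) \<le> C * (ln (real n) / real n) powr (2 / real d) \<or>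
       (\<exists>\<epsilon>>0. \<epsilon> \<le> \<kappa> / 50 \<and> \<epsilon> + 3 * \<epsilon>\<^sup>2 \<le> \<kappa> / 2 \<and>
          2 * (\<epsilon>\<^sup>2 + 5 / (2 * \<kappa>) * (\<epsilon> + 2 * \<epsilon>\<^sup>2)\<^sup>2) +
            2 * (2 * R + 1) * (pb / (\<epsilon> / 2) ^ d * exp (- (real n * (q0 * (\<epsilon> / 2) ^ d))))
          \<le> C * (ln (real n) / real n) powr (2 / real d))"
    using resolution_tradeoff[OF assms(1,3) less_imp_le[OF R(1)] q0 pb] by blast
  have "minimax_risk d \<kappa> K b B n \<le> ennreal (C * (ln (real n) / real n) powr (2 / real d))"
    if n: "2 \<le> n" for n
    using rate[OF n]
  proof (elim disjE exE conjE)
    let ?t = "C * (ln (real n) / real n) powr (2 / real d)"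
    \<comment> \<open>A constant estimator suffices for small samples.\<close>
    assume large: "2 * (2 * R + 1) \<le> ?t"
    obtain M0 where M0: "M0 \<in> ?\<M>" using False by blast
    show ?thesis
    proof (rule minimax_risk_le)
      show "(\<lambda>_. M0) \<in> estimators n" by (simp add: estimators_def)
      fix M Q assume M: "M \<in> ?\<M>" and Q: "Q \<in> dists_on d b B M"
      then interpret Q: prob_space Q by (simp add: dists_on_def)
      interpret N: prob_space "Pi\<^sub>M {..<n} (\<lambda>_. Q)" by (intro prob_space_PiM Q.prob_space_axioms)
      have "hausdorff_dist M0 M \<le> ennreal (2 * (2 * R + 1))"
        using R(1) by (intro hausdorff_dist_le_of_subset_cball ne MR M M0) auto
      also have "\<dots> \<le> ennreal ?t" using large by (rule ennreal_leI)
      finally show "(\<integral>\<^sup>+ y. hausdorff_dist M0 M \<partial>(Pi\<^sub>M {..<n} (\<lambda>_. Q))) \<le> ennreal ?t"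
        by (simp add: N.emeasure_space_1)
    qed
  next
    let ?t = "C * (ln (real n) / real n) powr (2 / real d)"
    fix \<epsilon> assume \<epsilon>: "0 < \<epsilon>" "\<epsilon> \<le> \<kappa> / 50" "\<epsilon> + 3 * \<epsilon>\<^sup>2 \<le> \<kappa> / 2"
      and bound: "2 * (\<epsilon>\<^sup>2 + 5 / (2 * \<kappa>) * (\<epsilon> + 2 * \<epsilon>\<^sup>2)\<^sup>2) +
            2 * (2 * R + 1) * (pb / (\<epsilon> / 2) ^ d * exp (- (real n * (q0 * (\<epsilon> / 2) ^ d)))) \<le> ?t"
    have \<eta>: "0 < \<epsilon>\<^sup>2" using \<epsilon> by simp
    obtain \<F> where \<F>: "finite \<F>" "\<F> \<subseteq> ?\<M>"
      "\<And>M. M \<in> ?\<M> \<Longrightarrow> \<exists>F\<in>\<F>. (\<forall>x\<in>M. \<exists>y\<in>F. dist x y < \<epsilon>\<^sup>2) \<and> (\<forall>y\<in>F. \<exists>x\<in>M. dist y x < \<epsilon>\<^sup>2)"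
      by (rule finite_hausdorff_net[OF assms(4) MK \<eta>]) (assumption, erule (1) that, blast)
    have "\<F> \<noteq> {}" using False \<F>(3) by blast
    define F where "F = from_nat_into \<F>"
    have range_F: "range F = \<F>"
      unfolding F_def using \<open>\<F> \<noteq> {}\<close> countable_finite[OF \<F>(1)] by (rule range_from_nat_into)
    then have FM: "F j \<in> ?\<M>" for j using \<F>(2) by blast
    show ?thesis
    proof (rule minimax_risk_le[OF first_fit_in_estimators])
      fix M Q assume M: "M \<in> ?\<M>" and Q: "Q \<in> dists_on d b B M"
      obtain j where j: "\<forall>x\<in>M. \<exists>y\<in>F j. dist x y < \<epsilon>\<^sup>2" "\<forall>y\<in>F j. \<exists>x\<in>M. dist y x < \<epsilon>\<^sup>2"
        using \<F>(3)[OF M] range_F by blast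
      show "(\<integral>\<^sup>+ y. hausdorff_dist (first_fit n (\<epsilon>\<^sup>2) (\<epsilon> + \<epsilon>\<^sup>2) F y) M \<partial>(Pi\<^sub>M {..<n} (\<lambda>_. Q)))
          \<le> ennreal ?t"
        by (rule order_trans[OF first_fit_risk_le[where F = F and j = j, OF reach[OF M] reach[OF FM] Q assms(5) d MR[OF M] MR[OF FM]
              less_imp_le[OF R(1)] j \<epsilon>(1) \<eta> \<epsilon>(2,3) pb_def q0_def] ennreal_leI[OF bound]])
    qed
  qed
  then show ?thesis using C by blast
qed

end
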